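(* Let $d\ge2$. The set $\mathcal{C}_{ar,\mathcal{Q}}^d$ of all $C\in\mathcal{C}_{ar}^d$ for which there exists a Borel set $\Lambda\subseteq\mathbb{I}^{d-1}$ with $\lambda_{d-1}(\Lambda)=1$ such that for every $\mathbf{x}\in\Lambda$ the $(d-1)$-st order partial derivative $\partial_1\partial_2\cdots\partial_{d-1}C(\mathbf{x},y)$ does not exist on a dense set of $y\in(0,1)$, is dense in $(\mathcal{C}_{ar}^d,d_\infty)$.
   Context: $\mathbb{I}=[0,1]$; $\lambda_{d-1}$ is Lebesgue measure on $\mathbb{I}^{d-1}$. Points of $\mathbb{I}^d$ are written $(\mathbf{x},y)$ with $\mathbf{x}\in\mathbb{I}^{d-1}$, $y\in\mathbb{I}$; $\partial_i$ denotes the partial derivative in the $i$-th coordinate, and $\partial_1\cdots\partial_{d-1}C=\partial_1(\partial_2(\cdots\partial_{d-1}C))$. The uniform metric is $d_\infty(A,B)=\sup_{\mathbf{u}\in\mathbb{I}^d}|A(\mathbf{u})-B(\mathbf{u})|$. A generator is a continuous non-increasing $\psi:[0,\infty)\to\mathbb{I}$ with $\psi(0)=1$, $\psi(\infty):=\lim_{z\to\infty}\psi(z)=0$, strictly decreasing on $[0,\inf\{x:\psi(x)=0\})$ (with $\inf\emptyset=\infty$); its pseudo-inverse is $\varphi(y)=\inf\{z\in[0,\infty]:\psi(z)=y\}$, $y\in\mathbb{I}$. $\mathcal{C}_{ar}^d$ is the set of $d$-dimensional Archimedean copulas, i.e. copulas of the form $C(\mathbf{u})=\psi(\sum_{i=1}^d\varphi(u_i))$,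 $\mathbf{u}\in\mathbb{I}^d$ (this function is a copula iff $\psi$ is $d$-monotone, i.e., with $\psi$ continuous on $[0,\infty)$, on $(0,\infty)$ $\psi$ is differentiable up to order $d-2$, $(-1)^k\psi^{(k)}\ge0$ for $k\le d-2$, and $(-1)^{d-2}\psi^{(d-2)}$ is non-increasing and convex). *)

theory Defs
  imports "HOL-Analysis.Analysis"
begin

(* Points of the d-dimensional unit cube are extensional functions on {..<d}; coordinates are
   numbered from 0, so (x, y) with x in the (d-1)-dimensional cube is x(d - 1 := y). *)

definition cube :: "nat \<Rightarrow> (nat \<Rightarrow> real) set" where
  "cube d = (\<Pi>\<^sub>E i\<in>{..<d}. {0..1})"

(* Lebesgue measure on the Borel sets of R^n. *)
definition lborel_n :: "nat \<Rightarrow> (nat \<Rightarrow> real) measure" where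
  "lborel_n n = (\<Pi>\<^sub>M i\<in>{..<n}. lborel)"

(* The sum is the inclusion-exclusion expression for the C-volume of the box [a, b]. *)
definition d_increasing :: "nat \<Rightarrow> ((nat \<Rightarrow> real) \<Rightarrow> real) \<Rightarrow> bool" where
  "d_increasing d C \<longleftrightarrow>
     (\<forall>a\<in>cube d. \<forall>b\<in>cube d. (\<forall>i<d. a i \<le> b i) \<longrightarrow>
        0 \<le> (\<Sum>S\<in>Pow {..<d}. (- 1) ^ card S * C (\<lambda>i. if i \<in> S then a i else b i)))"

definition copula :: "nat \<Rightarrow> ((nat \<Rightarrow> real) \<Rightarrow> real) \<Rightarrow> bool" where
  "copula d C \<longleftrightarrow>
     C \<in> cube d \<rightarrow>\<^sub>E {0..1} \<and>
     (\<forall>u\<in>cube d. (\<exists>i<d. u i = 0) \<longrightarrow> C u = 0) \<and>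
     (\<forall>u\<in>cube d. \<forall>i<d. (\<forall>j<d. j \<noteq> i \<longrightarrow> u j = 1) \<longrightarrow> C u = u i) \<and>
     d_increasing d C"

(* Only the values of psi on [0, infinity) matter.  The infimum is taken in [0, infinity], where
   Inf {} = infinity. *)
definition generator :: "(real \<Rightarrow> real) \<Rightarrow> bool" where
  "generator \<psi> \<longleftrightarrow>
     \<psi> ` {0..} \<subseteq> {0..1} \<and>
     continuous_on {0..} \<psi> \<and>
     antimono_on {0..} \<psi> \<and>
     \<psi> 0 = 1 \<and>
     (\<psi> \<longlongrightarrow> 0) at_top \<and>
     strict_antimono_on {x. 0 \<le> x \<and> ennreal x < Inf (ennreal ` {z. 0 \<le> z \<and> \<psi> z = 0})} \<psi>"

(* psi extended to [0, infinity] by its limit. *)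
definition gen_ext :: "(real \<Rightarrow> real) \<Rightarrow> ennreal \<Rightarrow> real" where
  "gen_ext \<psi> z = (if z = \<infinity> then Lim at_top \<psi> else \<psi> (enn2real z))"

definition pseudo_inverse :: "(real \<Rightarrow> real) \<Rightarrow> real \<Rightarrow> ennreal" where
  "pseudo_inverse \<psi> y = Inf {z. gen_ext \<psi> z = y}"

(* Copulas are extensional functions on the cube, so that equality of functions is equality on
   the cube. *)
definition archimedean :: "nat \<Rightarrow> (real \<Rightarrow> real) \<Rightarrow> (nat \<Rightarrow> real) \<Rightarrow> real" where
  "archimedean d \<psi> = (\<lambda>u\<in>cube d. gen_ext \<psi> (\<Sum>i<d. pseudo_inverse \<psi> (u i)))"

definition archimedean_copulas :: "nat \<Rightarrow> ((nat \<Rightarrow> real) \<Rightarrow> real) set" where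
  "archimedean_copulas d = {C. copula d C \<and> (\<exists>\<psi>. generator \<psi> \<and> C = archimedean d \<psi>)}"

definition uniform_dist :: "nat \<Rightarrow> ((nat \<Rightarrow> real) \<Rightarrow> real) \<Rightarrow> ((nat \<Rightarrow> real) \<Rightarrow> real) \<Rightarrow> real" where
  "uniform_dist d A B = (SUP u\<in>cube d. \<bar>A u - B u\<bar>)"

(* has_iterated_partial [i1, ..., ik] F u D: the iterated partial derivative d_i1 (... (d_ik F))
   of a function F on a unit cube exists at u and equals D.  For d_i of a function to exist at u,
   that function has to exist at all points near u on the line through u in direction i; g is its
   restriction to that line.  Derivatives at the boundary of the cube are one-sided. *)
primrec has_iterated_partial ::
    "nat list \<Rightarrow> ((nat \<Rightarrow> real) \<Rightarrow> real) \<Rightarrow> (nat \<Rightarrow> real) \<Rightarrow> real \<Rightarrow> bool" where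
  "has_iterated_partial [] F u D \<longleftrightarrow> F u = D"
| "has_iterated_partial (i # is) F u D \<longleftrightarrow>
     (\<exists>g. (\<exists>e>0. \<forall>t\<in>{0..1}. dist t (u i) < e \<longrightarrow> has_iterated_partial is F (u(i := t)) (g t)) \<and>
          (g has_real_derivative D) (at (u i) within {0..1}))"

definition archimedean_copulas_Q :: "nat \<Rightarrow> ((nat \<Rightarrow> real) \<Rightarrow> real) set" where
  "archimedean_copulas_Q d =
     {C \<in> archimedean_copulas d.
        \<exists>\<Lambda>. \<Lambda> \<in> sets (lborel_n (d - 1)) \<and> \<Lambda> \<subseteq> cube (d - 1) \<and> emeasure (lborel_n (d - 1)) \<Lambda> = 1 \<and>
          (\<forall>x\<in>\<Lambda>. {0<..<1} \<subseteq> closure {y \<in> {0<..<1}.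
             \<not> (\<exists>D. has_iterated_partial [0..<d - 1] C (x(d - 1 := y)) D)})}"

end

theory Submission
  imports Defs
begin

text \<open>Let \<open>\<psi>\<close> be the generator of the given copula and let \<open>\<eta>(z) = \<Sum>\<^sub>n 2\<^bsup>-n-1\<^esup> (1 - z/q\<^sub>n)\<^sub>+\<^bsup>d-1\<^esup>\<close> where
  \<open>q\<^sub>n\<close> runs through the positive rationals.  The approximating generator is
  \<open>\<phi> = (1 - \<delta>) \<psi> + \<delta> \<eta>\<close>.  The copula property is equivalent to nonnegativity of the alternating
  finite differences of the generator up to order \<open>d\<close>, a condition that is preserved by such mixtures.
  For every \<open>n\<close> we can write \<open>\<phi> = c (q\<^sub>n - z)\<^sub>+\<^bsup>d-1\<^esup> + \<rho>\<close> with \<open>c > 0\<close> and \<open>\<rho>\<close> satisfying the same condition,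
  so that \<open>\<rho>\<close> is \<open>d - 2\<close> times differentiable and \<open>(-1)\<^bsup>d-2\<^esup> \<rho>\<^bsup>(d-2)\<^esup>\<close> is convex: it cannot cancel
  the kink of the first summand, and \<open>\<phi>\<^bsup>(d-2)\<^esup>\<close> is not differentiable at \<open>q\<^sub>n\<close>.  The mixed partial
  derivative thus fails to exist whenever \<open>\<phi>\<close> is differentiable at the preimages of the first
  \<open>d - 1\<close> coordinates, which excludes countably many values per coordinate, and all \<open>d\<close> preimages
  add up to some \<open>q\<^sub>n\<close>.  For the distance, alternation of order 2 makes
  \<open>(z\<^sub>i) \<mapsto> \<psi> (\<Sum> z\<^sub>i)\<close> a contraction in the variables \<open>\<psi> (z\<^sub>i)\<close>, which gives the bound
  \<open>(d + 1) \<delta>\<close>.\<close>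

subsection \<open>Midpoint convexity\<close>

text \<open>If \<open>f\<close> exceeded its chord \<open>L\<close>, take the leftmost maximiser
  \<open>c\<close> of \<open>g = f - L\<close> on the interval. It is interior, and \<open>g\<close>
  is strictly smaller at \<open>c - h\<close> and no larger at \<open>c + h\<close>, against the
  midpoint inequality at \<open>c\<close>.\<close>

lemma midpoint_convex_imp_convex_on:
  fixes f :: "real \<Rightarrow> real"
  assumes A: "convex A" and cont: "continuous_on A f"
    and mid: "\<And>x h. h > 0 \<Longrightarrow> x - h \<in> A \<Longrightarrow> x + h \<in> A \<Longrightarrow> 2 * f x \<le> f (x - h) + f (x + h)"
  shows "convex_on A f"
proof (rule convex_on_linorderI[OF _ A])
  fix t x y :: real
  assume t: "t > 0" "t < 1" and xy: "x \<in> A" "y \<in> A" "x < y"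
  define K where "K = (f y - f x) / (y - x)"
  have K: "K * (y - x) = f y - f x" using xy by (simp add: K_def)
  define L where "L s = f x + K * (s - x)" for s
  define g where "g s = f s - L s" for s
  have sub: "{x..y} \<subseteq> A"
    using closed_segment_subset[OF xy(1,2) A] xy(3) by (simp add: closed_segment_eq_real_ivl)
  have cg: "continuous_on {x..y} g"
    unfolding g_def L_def by (intro continuous_intros continuous_on_subset[OF cont sub])
  have gxy: "g x = 0" "g y = 0" using K by (simp_all add: g_def L_def)
  have "g s \<le> 0" if s: "s \<in> {x..y}" for s
  proof (rule ccontr)
    assume "\<not> g s \<le> 0"
    obtain m where m: "m \<in> {x..y}" "\<And>s. s \<in> {x..y} \<Longrightarrow> g s \<le> g m"
      using continuous_attains_sup[OF _ _ cg] xy by fastforce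
    have pos: "g m > 0" using m s \<open>\<not> g s \<le> 0\<close> by force
    have cl: "closed {s \<in> {x..y}. g s = g m}"
      using continuous_closed_preimage_constant[OF cg] by simp
    have cpt: "compact {s \<in> {x..y}. g s = g m}"
      using compact_Int_closed[OF compact_Icc[of x y] cl]
      by (rule back_subst[where P = compact]) auto
    have "m \<in> {s \<in> {x..y}. g s = g m}" using m by simp
    then obtain c where c: "c \<in> {x..y}" "g c = g m" "\<And>s. s \<in> {x..y} \<Longrightarrow> g s = g m \<Longrightarrow> c \<le> s"
      using compact_attains_inf[OF cpt] by blast
    have "c \<noteq> x" "c \<noteq> y" using c(2) gxy pos by auto
    then have cxy: "x < c" "c < y" using c(1) by auto
    define h where "h = min (c - x) (y - c)"
    have h: "h > 0" "c - h \<in> {x..y}" "c + h \<in> {x..y}" using cxy by (auto simp: h_def)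
    have "g (c - h) \<noteq> g m" using c(3)[OF h(2)] h(1) by auto
    then have "g (c - h) < g m" using m(2)[OF h(2)] by simp
    moreover have "g (c + h) \<le> g m" using m(2)[OF h(3)] .
    moreover have "2 * f c \<le> f (c - h) + f (c + h)" using mid[OF h(1)] h sub by blast
    moreover have "2 * L c = L (c - h) + L (c + h)"
      by (simp add: L_def algebra_simps)
    ultimately show False using c(2) by (simp add: g_def)
  qed
  note le = this
  have "(1 - t) *\<^sub>R x + t *\<^sub>R y \<in> {x..y}"
    using t xy convexD_alt[of "{x..y}" x y t] by simp
  from le[OF this] have "f ((1 - t) *\<^sub>R x + t *\<^sub>R y) \<le> L ((1 - t) *\<^sub>R x + t *\<^sub>R y)"
    by (simp add: g_def)
  also have "\<dots> = (1 - t) * f x + t * f y"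
  proof -
    have "L ((1 - t) *\<^sub>R x + t *\<^sub>R y) = f x + t * (K * (y - x))"
      by (simp add: L_def algebra_simps)
    also have "\<dots> = (1 - t) * f x + t * f y" unfolding K by (simp add: algebra_simps)
    finally show ?thesis .
  qed
  finally show "f ((1 - t) *\<^sub>R x + t *\<^sub>R y) \<le> (1 - t) * f x + t * f y" .
qed

subsection \<open>One-sided slopes of convex functions\<close>

text \<open>For convex \<open>f\<close> the slopes decrease as \<open>h\<close> decreases to 0, so
  this infimum is the right derivative. As an infimum it makes sense before any limit is known to
  exist.\<close>

definition right_slope :: "(real \<Rightarrow> real) \<Rightarrow> real \<Rightarrow> real" where
  "right_slope f z = (INF h\<in>{0<..}. (f (z + h) - f z) / h)"

text \<open>By the three-slope inequality every slope to the left of \<open>z\<close> is a lower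
  bound for all slopes to the right of \<open>z\<close>. So the infimum is over a set bounded below
  and separates the two families; monotonicity of the slopes in \<open>h\<close> turns it into a
  limit.\<close>

lemma
  fixes f :: "real \<Rightarrow> real"
  assumes f: "convex_on {0<..} f" and z: "z > 0"
  shows right_slope_le: "z < w \<Longrightarrow> right_slope f z \<le> (f w - f z) / (w - z)"
    and right_slope_ge: "0 < v \<Longrightarrow> v < z \<Longrightarrow> (f z - f v) / (z - v) \<le> right_slope f z"
    and tendsto_right_slope: "((\<lambda>h. (f (z + h) - f z) / h) \<longlongrightarrow> right_slope f z) (at_right 0)"
proof -
  have ge: "(f z - f v) / (z - v) \<le> (f (z + h) - f z) / h" if "0 < v" "v < z" "h > 0" for v h
    using convex_on_slope_le[OF f, of v "z + h" z] that z
    by (simp add: field_simps)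
  have bdd: "bdd_below ((\<lambda>h. (f (z + h) - f z) / h) ` {0<..})"
    using ge[of "z / 2"] z by (intro bdd_belowI2) auto
  show le: "right_slope f z \<le> (f w - f z) / (w - z)" if "z < w" for w
    unfolding right_slope_def using cINF_lower[OF bdd, of "w - z"] that by simp
  show "(f z - f v) / (z - v) \<le> right_slope f z" if "0 < v" "v < z" for v
    unfolding right_slope_def using ge that by (intro cINF_greatest) auto
  show "((\<lambda>h. (f (z + h) - f z) / h) \<longlongrightarrow> right_slope f z) (at_right 0)"
  proof (rule order_tendstoI)
    fix a assume "a < right_slope f z"
    have "a < (f (z + h) - f z) / h" if "h > 0" for h
      using le[of "z + h"] that \<open>a < _\<close> by simp
    then show "\<forall>\<^sub>F h in at_right 0. a < (f (z + h) - f z) / h"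
      by (auto simp: eventually_at_right_field intro!: exI[of _ 1])
  next
    fix a assume "right_slope f z < a"
    then obtain h where h: "h > 0" "(f (z + h) - f z) / h < a"
      unfolding right_slope_def using cINF_less_iff[OF _ bdd] by auto
    have "(f (z + k) - f z) / k \<le> (f (z + h) - f z) / h" if "0 < k" "k < h" for k
      using convex_on_slope_le(1)[OF f, of z "z + h" "z + k"] that z
      by (simp add: field_simps)
    then show "\<forall>\<^sub>F h in at_right 0. (f (z + h) - f z) / h < a"
      using h by (fastforce simp: eventually_at_right_field)
  qed
qed

lemma mono_on_right_slope:
  assumes "convex_on {0<..} f"
  shows "mono_on {0<..} (right_slope f)"
proof (rule mono_onI)
  fix v w :: real assume "v \<in> {0<..}" "w \<in> {0<..}" "v \<le> w"
  then show "right_slope f v \<le> right_slope f w"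
    using right_slope_le[OF assms, of v w] right_slope_ge[OF assms, of w v]
    by (cases "v = w") auto
qed

text \<open>On either side of \<open>z\<close> the difference quotient towards \<open>w\<close> lies
  between the right slopes at \<open>z\<close> and at \<open>w\<close>. Continuity of the right
  slope squeezes it.\<close>

lemma has_real_derivative_right_slope:
  assumes f: "convex_on {0<..} f" and z: "z > 0" and c: "isCont (right_slope f) z"
  shows "(f has_real_derivative right_slope f z) (at z)"
  unfolding has_field_derivative_iff
proof (rule tendsto_sandwich)
  let ?r = "right_slope f"
  have lim: "(?r \<longlongrightarrow> ?r z) (at z)" using c by (simp add: isCont_def)
  show "((\<lambda>w. min (?r z) (?r w)) \<longlongrightarrow> ?r z) (at z)"
    using tendsto_min[OF tendsto_const[of "?r z"] lim] by simp
  show "((\<lambda>w. max (?r z) (?r w)) \<longlongrightarrow> ?r z) (at z)"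
    using tendsto_max[OF tendsto_const[of "?r z"] lim] by simp
  have "\<forall>\<^sub>F w in at z. w > 0 \<and> w \<noteq> z"
    using z by (auto simp: eventually_conj_iff eventually_neq_at_within
      intro!: order_tendstoD(1)[OF tendsto_ident_at])
  then have "\<forall>\<^sub>F w in at z. min (?r z) (?r w) \<le> (f w - f z) / (w - z) \<and>
      (f w - f z) / (w - z) \<le> max (?r z) (?r w)"
  proof eventually_elim
    case (elim w)
    have *: "(f w - f z) / (w - z) = (f z - f w) / (z - w)"
      by (metis minus_diff_eq minus_divide_divide)
    show ?case
    proof (cases "z < w")
      case True
      then show ?thesis using right_slope_le[OF f z True] right_slope_ge[OF f, of w z] z elim by auto
    next
      case False
      then have "w < z" using elim by simp
      then show ?thesis using right_slope_le[OF f, of w z] right_slope_ge[OF f z, of w] elim *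
        by auto
    qed
  qed
  then show "\<forall>\<^sub>F w in at z. min (?r z) (?r w) \<le> (f w - f z) / (w - z)"
    "\<forall>\<^sub>F w in at z. (f w - f z) / (w - z) \<le> max (?r z) (?r w)"
    by (auto elim: eventually_mono)
qed

text \<open>The right slope is monotone, hence has countably many discontinuities, and
  \<open>f\<close> is differentiable at all other points.\<close>

lemma convex_on_countable_nondifferentiable:
  fixes f :: "real \<Rightarrow> real"
  assumes "convex_on {0<..} f"
  shows "countable {z\<in>{0<..}. \<not> f differentiable at z}"
proof (rule countable_subset)
  show "countable {z\<in>{0<..}. \<not> isCont (right_slope f) z}"
    by (intro mono_on_ctble_discont_open mono_on_right_slope assms) simp
qed (use has_real_derivative_right_slope[OF assms] in \<open>auto simp: real_differentiable_def\<close>)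

subsection \<open>Functions with alternating finite differences\<close>

text \<open>This is the iterated forward difference with the sign \<open>(- 1) ^ length hs\<close>,
  so that decreasing convex behaviour gives nonnegative values. The steps may differ from each
  other.\<close>

primrec alt_diff :: "real list \<Rightarrow> (real \<Rightarrow> real) \<Rightarrow> real \<Rightarrow> real" where
  "alt_diff [] f z = f z"
| "alt_diff (h # hs) f z = alt_diff hs f z - alt_diff hs f (z + h)"

text \<open>A finite-difference form of \<open>k\<close>-monotonicity. It needs no derivatives and
  passes to sums, nonnegative multiples and pointwise limits. Order 0 is nonnegativity, order 1
  monotonicity, order 2 convexity up to continuity.\<close>

definition alternating :: "real set \<Rightarrow> nat \<Rightarrow> (real \<Rightarrow> real) \<Rightarrow> bool" where
  "alternating A k f \<longleftrightarrow>
     (\<forall>hs. length hs \<le> k \<longrightarrow> (\<forall>h\<in>set hs. 0 \<le> h) \<longrightarrow> (\<forall>z\<in>A. 0 \<le> alt_diff hs f z))"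

lemma alternatingD:
  "alternating A k f \<Longrightarrow> length hs \<le> k \<Longrightarrow> \<forall>h\<in>set hs. 0 \<le> h \<Longrightarrow> z \<in> A \<Longrightarrow> 0 \<le> alt_diff hs f z"
  by (simp add: alternating_def)

lemma alternating_mono:
  "alternating A k f \<Longrightarrow> j \<le> k \<Longrightarrow> B \<subseteq> A \<Longrightarrow> alternating B j f"
  unfolding alternating_def by (simp add: subset_iff)

text \<open>Difference operators commute, so the outermost one may be applied to \<open>f\<close>
  first.\<close>

lemma alt_diff_Cons': "alt_diff (h # hs) f z = alt_diff hs (\<lambda>w. f w - f (w + h)) z"
proof (induction hs arbitrary: z)
  case (Cons a hs)
  then show ?case by (simp add: Cons.IH[symmetric] ac_simps)
qed simp

lemma alt_diff_add: "alt_diff hs (\<lambda>w. f w + g w) z = alt_diff hs f z + alt_diff hs g z"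
  by (induction hs arbitrary: z) simp_all

lemma alt_diff_cmult: "alt_diff hs (\<lambda>w. c * f w) z = c * alt_diff hs f z"
  by (induction hs arbitrary: z) (simp_all add: right_diff_distrib)

lemma alt_diff_sums:
  assumes "\<And>w. w \<ge> z \<Longrightarrow> (\<lambda>n. f n w) sums g w" "\<forall>h\<in>set hs. 0 \<le> h"
  shows "(\<lambda>n. alt_diff hs (f n) z) sums alt_diff hs g z"
  using assms
proof (induction hs arbitrary: z)
  case (Cons h hs)
  have "(\<lambda>n. alt_diff hs (f n) z) sums alt_diff hs g z" "(\<lambda>n. alt_diff hs (f n) (z + h)) sums alt_diff hs g (z + h)"
    using Cons.prems by (auto intro!: Cons.IH Cons.prems(1))
  then show ?case by (simp add: sums_diff)
qed simp

lemma alt_diff_tendsto: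
  assumes "\<And>w. w \<ge> z \<Longrightarrow> ((\<lambda>t. f t w) \<longlongrightarrow> g w) F" "\<forall>h\<in>set hs. 0 \<le> h"
  shows "((\<lambda>t. alt_diff hs (f t) z) \<longlongrightarrow> alt_diff hs g z) F"
  using assms
proof (induction hs arbitrary: z)
  case (Cons h hs)
  have "((\<lambda>t. alt_diff hs (f t) z) \<longlongrightarrow> alt_diff hs g z) F" "((\<lambda>t. alt_diff hs (f t) (z + h)) \<longlongrightarrow> alt_diff hs g (z + h)) F"
    using Cons.prems by (auto intro!: Cons.IH Cons.prems(1))
  then show ?case by (simp add: tendsto_diff)
qed simp

lemma alt_diff_tendsto_at_top:
  assumes "(f \<longlongrightarrow> 0) at_top"
  shows "(alt_diff hs f \<longlongrightarrow> 0) at_top"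
proof (induction hs)
  case (Cons h hs)
  have "filterlim (\<lambda>z::real. z + h) at_top at_top"
    using filterlim_tendsto_add_at_top[OF tendsto_const[of h] filterlim_ident] by (simp add: add.commute)
  from filterlim_compose[OF Cons this] have "((\<lambda>z. alt_diff hs f z - alt_diff hs f (z + h)) \<longlongrightarrow> 0 - 0) at_top"
    by (intro tendsto_diff Cons)
  then show ?case by simp
qed (use assms in simp)

lemma alternating_add:
  "alternating A k f \<Longrightarrow> alternating A k g \<Longrightarrow> alternating A k (\<lambda>z. f z + g z)"
  unfolding alternating_def alt_diff_add by simp

lemma alternating_cmult:
  "0 \<le> c \<Longrightarrow> alternating A k f \<Longrightarrow> alternating A k (\<lambda>z. c * f z)"
  unfolding alternating_def alt_diff_cmult by simp

text \<open>Only the top order has to be checked. Nonnegativity at order \<open>j + 1\<close> says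
  that a difference of order \<open>j\<close> does not increase when its base point moves right; as
  it tends to 0 at infinity, it is nonnegative. Hence the descending induction.\<close>

lemma alternatingI_tendsto_0:
  assumes lim: "(f \<longlongrightarrow> 0) at_top"
    and nonneg: "\<And>hs z. length hs = k \<Longrightarrow> \<forall>h\<in>set hs. 0 \<le> h \<Longrightarrow> 0 \<le> z \<Longrightarrow> 0 \<le> alt_diff hs f z"
  shows "alternating {0..} k f"
proof -
  have "0 \<le> alt_diff hs f z" if "j \<le> k" "length hs = j" "\<forall>h\<in>set hs. 0 \<le> h" "0 \<le> z" for j hs z
    using that
  proof (induction j arbitrary: hs z rule: inc_induct)
    case base
    then show ?case using nonneg by auto
  next
    case (step j)
    have "((\<lambda>h. alt_diff hs f (z + h)) \<longlongrightarrow> 0) at_top"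
      using alt_diff_tendsto_at_top[OF lim]
      by (rule filterlim_compose) (rule filterlim_tendsto_add_at_top[OF tendsto_const filterlim_ident])
    moreover have "\<forall>\<^sub>F h in at_top. alt_diff hs f (z + h) \<le> alt_diff hs f z"
      using eventually_ge_at_top[of 0]
    proof eventually_elim
      case (elim h)
      then show ?case using step.IH[of "h # hs" z] step.prems by auto
    qed
    ultimately show ?case by (rule tendsto_upperbound) simp
  qed
  then show ?thesis by (simp add: alternating_def)
qed

text \<open>Order 2 with steps \<open>h\<close> and \<open>r\<close>: the decrease over an interval
  of length \<open>h\<close> can only shrink when the interval is shifted to the right by
  \<open>r\<close>.\<close>

lemma alt_diff_monotone_step:
  assumes "alternating A k f" "2 \<le> k" "z \<in> A" "0 \<le> h" "0 \<le> r"
  shows "f (z + r) - f (z + h + r) \<le> f z - f (z + h)"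
  using alternatingD[OF assms(1), of "[h, r]" z] assms by (simp add: algebra_simps)

lemma alternating_imp_antimono_on:
  assumes "alternating A k f" "1 \<le> k"
  shows "antimono_on A f"
proof (rule monotone_onI)
  fix x y assume "x \<in> A" "y \<in> A" "x \<le> y"
  then show "f y \<le> f x" using alternatingD[OF assms(1), of "[y - x]" x] assms(2) by simp
qed

lemma alternating_imp_convex_on:
  assumes "continuous_on {0<..} f" "alternating {0<..} k f" "2 \<le> k"
  shows "convex_on {0<..} f"
proof (rule midpoint_convex_imp_convex_on)
  fix x h :: real assume "h > 0" "x - h \<in> {0<..}"
  then show "2 * f x \<le> f (x - h) + f (x + h)"
    using alt_diff_monotone_step[OF assms(2,3), of "x - h" h h] by simp
qed (use assms in auto)

text \<open>The difference quotients of a function of alternating order \<open>k + 1\<close> have alternating order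
  \<open>k\<close>, and so does their limit, minus the right slope.  As \<open>k \<ge> 2\<close>, that limit is convex, hence
  continuous, which turns the right slope into a derivative.\<close>

lemma alternating_derivative:
  assumes cont: "continuous_on {0<..} f" and alt: "alternating {0<..} (Suc k) f" and k: "2 \<le> k"
  obtains g where "\<And>z. z > 0 \<Longrightarrow> (f has_real_derivative - g z) (at z)"
    "continuous_on {0<..} g" "alternating {0<..} k g"
proof -
  have conv: "convex_on {0<..} f"
    using alternating_imp_convex_on[OF cont alt] k by simp
  define g where "g z = - right_slope f z" for z
  define q where "q h z = inverse h * (f z - f (z + h))" for h z
  have lim: "((\<lambda>h. q h z) \<longlongrightarrow> g z) (at_right 0)" if "z > 0" for z
  proof -
    have "q h z = - ((f (z + h) - f z) / h)" for h
      by (simp add: q_def divide_inverse algebra_simps)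
    then show ?thesis unfolding g_def using tendsto_minus[OF tendsto_right_slope[OF conv that]] by simp
  qed
  have q: "alternating {0<..} k (q h)" if "h > 0" for h
    unfolding alternating_def
  proof (intro allI impI ballI)
    fix hs :: "real list" and z :: real
    assume hs: "length hs \<le> k" "\<forall>h\<in>set hs. 0 \<le> h" "z \<in> {0<..}"
    have "0 \<le> alt_diff (h # hs) f z"
      using alternatingD[OF alt, of "h # hs" z] hs that by (auto simp del: alt_diff.simps)
    then show "0 \<le> alt_diff hs (q h) z"
      using that unfolding q_def alt_diff_cmult by (simp add: alt_diff_Cons' del: alt_diff.simps)
  qed
  have alt_g: "alternating {0<..} k g"
    unfolding alternating_def
  proof (intro allI impI ballI)
    fix hs :: "real list" and z :: real
    assume hs: "length hs \<le> k" "\<forall>h\<in>set hs. 0 \<le> h" "z \<in> {0<..}"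
    have "((\<lambda>h. alt_diff hs (q h) z) \<longlongrightarrow> alt_diff hs g z) (at_right 0)"
      using hs by (intro alt_diff_tendsto lim) auto
    moreover have "\<forall>\<^sub>F h in at_right 0. 0 \<le> alt_diff hs (q h) z"
      using eventually_at_right_less[of 0]
    proof eventually_elim
      case (elim h)
      then show ?case using alternatingD[OF q[OF elim], of hs z] hs by auto
    qed
    ultimately show "0 \<le> alt_diff hs g z" by (rule tendsto_lowerbound) simp
  qed
  have "convex_on {0<..} (q h)" if "h > 0" for h
  proof (rule alternating_imp_convex_on[OF _ q[OF that] k])
    show "continuous_on {0<..} (q h)" unfolding q_def using that
      by (intro continuous_intros continuous_on_compose2[OF cont] cont) auto
  qed
  then have q_conv: "q h ((1 - t) *\<^sub>R x + t *\<^sub>R y) \<le> (1 - t) * q h x + t * q h y"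
    if "h > 0" "0 < t" "t < 1" "0 < x" "0 < y" for h t x y
    using that by (intro convex_onD[where A = "{0<..}"]) auto
  have "convex_on {0<..} g"
  proof (rule convex_onI)
    fix t x y :: real assume t: "0 < t" "t < 1" and xy: "x \<in> {0<..}" "y \<in> {0<..}"
    have "(1 - t) *\<^sub>R x + t *\<^sub>R y > 0" using t xy by (simp add: add_pos_pos)
    then have "((\<lambda>h. q h ((1 - t) *\<^sub>R x + t *\<^sub>R y)) \<longlongrightarrow> g ((1 - t) *\<^sub>R x + t *\<^sub>R y)) (at_right 0)"
      by (rule lim)
    moreover have "((\<lambda>h. (1 - t) * q h x + t * q h y) \<longlongrightarrow> (1 - t) * g x + t * g y) (at_right 0)"
      using xy by (intro tendsto_intros lim) auto
    moreover have "\<forall>\<^sub>F h in at_right 0. q h ((1 - t) *\<^sub>R x + t *\<^sub>R y) \<le> (1 - t) * q h x + t * q h y"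
      using eventually_at_right_less[of 0] by eventually_elim (use q_conv t xy in auto)
    ultimately show "g ((1 - t) *\<^sub>R x + t *\<^sub>R y) \<le> (1 - t) * g x + t * g y"
      by (intro tendsto_le[OF trivial_limit_at_right_real])
  qed simp
  then have cont_g: "continuous_on {0<..} g"
    by (intro convex_on_continuous) auto
  have "(f has_real_derivative - g z) (at z)" if "z > 0" for z
  proof -
    have "isCont (\<lambda>z. - g z) z"
      using cont_g that by (auto simp: continuous_on_eq_continuous_at intro!: continuous_minus)
    then show ?thesis
      using has_real_derivative_right_slope[OF conv that] by (simp add: g_def)
  qed
  then show ?thesis using that cont_g alt_g by blast
qed

text \<open>Each derivative costs one order and one sign; the two orders left at the end express
  convexity of the last derivative.\<close>

lemma alternating_derivatives:
  assumes "continuous_on {0<..} f" "alternating {0<..} (m + 2) f"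
  shows "\<exists>F. F 0 = f \<and> (\<forall>j<m. \<forall>z>0. (F j has_real_derivative F (Suc j) z) (at z)) \<and>
           alternating {0<..} 2 (\<lambda>z. (- 1) ^ m * F m z)"
  using assms
proof (induction m arbitrary: f)
  case 0
  then show ?case by (intro exI[of _ "\<lambda>_. f"]) (simp add: numeral_2_eq_2)
next
  case (Suc m)
  obtain g where g: "\<And>z. z > 0 \<Longrightarrow> (f has_real_derivative - g z) (at z)"
    "continuous_on {0<..} g" "alternating {0<..} (m + 2) g"
    using alternating_derivative[OF Suc.prems(1), of "m + 2"] Suc.prems(2) by auto
  obtain G where G: "G 0 = g" "\<And>j z. j < m \<Longrightarrow> 0 < z \<Longrightarrow> (G j has_real_derivative G (Suc j) z) (at z)"
    "alternating {0<..} 2 (\<lambda>z. (- 1) ^ m * G m z)"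
    using Suc.IH[OF g(2,3)] by blast
  \<comment> \<open>\<open>G\<close> lists the derivatives of \<open>g\<close>, which is minus the
    derivative of \<open>f\<close>; hence the shift of the index and the sign.\<close>
  define F where "F j = (case j of 0 \<Rightarrow> f | Suc i \<Rightarrow> (\<lambda>z. - G i z))" for j
  have "(F j has_real_derivative F (Suc j) z) (at z)" if "j < Suc m" "0 < z" for j z
    using that g(1) G(1,2) by (cases j) (auto simp: F_def intro!: derivative_eq_intros)
  moreover have "alternating {0<..} 2 (\<lambda>z. (- 1) ^ Suc m * F (Suc m) z)"
    using G(3) by (simp add: F_def)
  moreover have "F 0 = f" by (simp add: F_def)
  ultimately show ?case by blast
qed

subsection \<open>Mixtures of truncated powers\<close>

text \<open>The derivative of order \<open>n - 1\<close> is a multiple of the positive part of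
  \<open>q - z\<close> and has a kink at \<open>q\<close>. For \<open>n = 0\<close> the function is
  constantly 1, hence the assumption \<open>0 < n\<close> below.\<close>

definition trunc_power :: "real \<Rightarrow> nat \<Rightarrow> real \<Rightarrow> real" where
  "trunc_power q n z = max 0 (q - z) ^ n"

lemma has_real_derivative_max_power:
  "((\<lambda>x. max 0 x ^ Suc (Suc n)) has_real_derivative real (Suc (Suc n)) * max 0 a ^ Suc n) (at a)"
proof (cases a "0 :: real" rule: linorder_cases)
  case less
  have "((\<lambda>x. 0) has_real_derivative 0) (at a)" by simp
  then have "((\<lambda>x. max 0 x ^ Suc (Suc n)) has_real_derivative 0) (at a)"
    by (rule has_field_derivative_transform_within_open[where S = "{..<0}"]) (use less in auto)
  then show ?thesis using less by simp
next
  case equal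
  \<comment> \<open>Caratheodory's criterion at 0: the power is \<open>x\<close> times the next
    lower power of \<open>max 0 x\<close>, which is continuous and vanishes at 0.\<close>
  show ?thesis unfolding equal CARAT_DERIV
  proof (intro exI[of _ "\<lambda>x. max 0 x ^ Suc n"] conjI allI)
    show "isCont (\<lambda>x::real. max 0 x ^ Suc n) 0" by (intro continuous_intros)
  qed (simp_all add: max_def)
next
  case greater
  have "((\<lambda>x. x ^ Suc (Suc n)) has_real_derivative real (Suc (Suc n)) * a ^ Suc n) (at a)"
    using DERIV_pow[of "Suc (Suc n)" a] by simp
  then have "((\<lambda>x. max 0 x ^ Suc (Suc n)) has_real_derivative real (Suc (Suc n)) * a ^ Suc n) (at a)"
    by (rule has_field_derivative_transform_within_open[where S = "{0<..}"]) (use greater in auto)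
  then show ?thesis using greater by simp
qed

lemma has_real_derivative_trunc_power:
  "(trunc_power q (Suc (Suc n)) has_real_derivative
     - real (Suc (Suc n)) * trunc_power q (Suc n) z) (at z)"
proof -
  have "((\<lambda>z. q - z) has_real_derivative - 1) (at z)"
    by (auto intro!: derivative_eq_intros)
  from DERIV_chain2[OF has_real_derivative_max_power this, of n] show ?thesis
    unfolding trunc_power_def by (simp only: mult_minus_right mult_minus_left mult_1_right)
qed

lemma trunc_power_nonneg: "0 \<le> trunc_power q n z"
  by (simp add: trunc_power_def)

lemma trunc_power_antimono: "z \<le> w \<Longrightarrow> trunc_power q n w \<le> trunc_power q n z"
  unfolding trunc_power_def by (intro power_mono) auto

lemma continuous_on_trunc_power: "continuous_on A (trunc_power q n)"
  unfolding trunc_power_def by (intro continuous_intros)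

lemma trunc_power_tendsto_0:
  assumes "0 < n"
  shows "(trunc_power q n \<longlongrightarrow> 0) at_top"
  using assms by (intro tendsto_eventually eventually_mono[OF eventually_ge_at_top[of q]])
    (auto simp: trunc_power_def)

section \<open>Finite differences of truncated powers\<close>

lemma alt_diff_fun: "alt_diff [] f = f" "alt_diff (h # hs) f = (\<lambda>z. alt_diff hs f z - alt_diff hs f (z + h))"
  by auto

lemma alt_diff_has_real_derivative:
  assumes "\<And>z. (f has_real_derivative f' z) (at z)"
  shows "(alt_diff hs f has_real_derivative alt_diff hs f' z) (at z)"
proof (induction hs arbitrary: z)
  case (Cons h hs)
  have "((\<lambda>z. alt_diff hs f (z + h)) has_real_derivative alt_diff hs f' (z + h)) (at z)"
    using Cons.IH[of "z + h"] by (simp add: DERIV_shift)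
  from DERIV_diff[OF Cons.IH this] show ?case by (simp add: alt_diff_fun)
qed (use assms in \<open>simp add: alt_diff_fun\<close>)

text \<open>Induction on the exponent. With one step held back, the derivative of the remaining
  difference is a negative multiple of the same difference of the next lower power, so that
  difference is nonincreasing and the last step gives a nonnegative value. The base case is
  convexity of the positive part.\<close>

lemma alt_diff_trunc_power_nonneg:
  assumes "length hs = Suc (Suc n)" "\<forall>h\<in>set hs. 0 \<le> h"
  shows "0 \<le> alt_diff hs (trunc_power q (Suc n)) z"
  using assms
proof (induction n arbitrary: hs z)
  case 0
  then obtain h r where "hs = [h, r]" by (auto simp: length_Suc_conv)
  then show ?case using 0 by (auto simp: trunc_power_def max_def)
next
  case (Suc n)
  obtain h hs' where hs: "hs = h # hs'" "length hs' = Suc (Suc n)" "0 \<le> h" "\<forall>h\<in>set hs'. 0 \<le> h"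
    using Suc.prems by (auto simp: length_Suc_conv)
  let ?p = "\<lambda>z. - real (Suc (Suc n)) * trunc_power q (Suc n) z"
  have "alt_diff hs' (trunc_power q (Suc (Suc n))) (z + h) \<le> alt_diff hs' (trunc_power q (Suc (Suc n))) z"
  proof (rule DERIV_nonpos_imp_nonincreasing[where f = "alt_diff hs' (trunc_power q (Suc (Suc n)))"])
    fix x
    have "(alt_diff hs' (trunc_power q (Suc (Suc n))) has_real_derivative alt_diff hs' ?p x) (at x)"
      by (intro alt_diff_has_real_derivative has_real_derivative_trunc_power)
    moreover have "alt_diff hs' ?p x \<le> 0"
      unfolding alt_diff_cmult using Suc.IH[OF hs(2,4), of x] by (simp only: mult_minus_left) simp
    ultimately show "\<exists>y. (alt_diff hs' (trunc_power q (Suc (Suc n))) has_real_derivative y) (at x) \<and> y \<le> 0"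
      by blast
  qed (use hs in simp)
  then show ?case by (simp add: hs)
qed

lemma alternating_trunc_power:
  assumes "0 < n"
  shows "alternating {0..} (Suc n) (trunc_power q n)"
proof (rule alternatingI_tendsto_0[OF trunc_power_tendsto_0[OF assms]])
  fix hs :: "real list" and z :: real
  assume "length hs = Suc n" "\<forall>h\<in>set hs. 0 \<le> h"
  then show "0 \<le> alt_diff hs (trunc_power q n) z"
    using alt_diff_trunc_power_nonneg[of hs "n - 1"] assms by simp
qed

text \<open>The Williamson transform of order \<open>m + 1\<close> of the discrete measure with
  masses \<open>w n\<close> at \<open>q n\<close>. Dividing by \<open>q n ^ m\<close> makes each
  summand equal to its weight at 0, so for \<open>z \<ge> 0\<close> the weights dominate the
  series.\<close>

definition mix :: "(nat \<Rightarrow> real) \<Rightarrow> (nat \<Rightarrow> real) \<Rightarrow> nat \<Rightarrow> real \<Rightarrow> real" where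
  "mix w q m z = (\<Sum>n. w n * (trunc_power (q n) m z / q n ^ m))"

context
  fixes w q :: "nat \<Rightarrow> real" and m :: nat
  assumes w: "\<And>n. 0 \<le> w n" "summable w" and q: "\<And>n. 0 < q n" and m: "0 < m"
begin

lemma mix_term_bounds:
  assumes "0 \<le> z"
  shows "0 \<le> trunc_power (q n) m z / q n ^ m" "trunc_power (q n) m z / q n ^ m \<le> 1"
proof -
  have "trunc_power (q n) m z \<le> trunc_power (q n) m 0"
    by (rule trunc_power_antimono[OF assms])
  then show "trunc_power (q n) m z / q n ^ m \<le> 1"
    using q[of n] by (simp add: trunc_power_def)
qed (use q[of n] in \<open>simp add: trunc_power_nonneg\<close>)

lemma norm_mix_term:
  assumes "0 \<le> z"
  shows "norm (w n * (trunc_power (q n) m z / q n ^ m)) \<le> w n"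
proof -
  have "0 \<le> w n * (trunc_power (q n) m z / q n ^ m)" "w n * (trunc_power (q n) m z / q n ^ m) \<le> w n"
    using mix_term_bounds[OF assms, of n] w(1)[of n] by (auto intro: mult_nonneg_nonneg mult_left_le simp del: times_divide_eq_right)
  then show ?thesis by simp
qed

lemma summable_mix:
  assumes "0 \<le> z"
  shows "summable (\<lambda>n. w n * (trunc_power (q n) m z / q n ^ m))"
  by (rule summable_comparison_test'[OF w(2), of 0]) (rule norm_mix_term[OF assms])

lemma mix_0: "mix w q m 0 = (\<Sum>n. w n)"
proof -
  have "trunc_power (q n) m 0 / q n ^ m = 1" for n
    using q[of n] by (simp add: trunc_power_def)
  then show ?thesis unfolding mix_def by (simp only: mult_1_right)
qed

lemma alternating_mix: "alternating {0..} (Suc m) (mix w q m)"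
  unfolding alternating_def
proof (intro allI impI ballI)
  fix hs :: "real list" and z :: real
  assume hs: "length hs \<le> Suc m" "\<forall>h\<in>set hs. 0 \<le> h" "z \<in> {0..}"
  have sums: "(\<lambda>n. alt_diff hs (\<lambda>z. w n * (trunc_power (q n) m z / q n ^ m)) z) sums alt_diff hs (mix w q m) z"
    using hs unfolding mix_def by (intro alt_diff_sums summable_sums summable_mix) auto
  have "0 \<le> alt_diff hs (\<lambda>z. w n * (trunc_power (q n) m z / q n ^ m)) z" for n
  proof -
    have "alternating {0..} (Suc m) (\<lambda>z. (w n / q n ^ m) * trunc_power (q n) m z)"
      using w(1)[of n] q[of n] m by (intro alternating_cmult alternating_trunc_power) auto
    from alternatingD[OF this hs] show ?thesis by simp
  qed
  from sums_le[OF this sums_zero sums] show "0 \<le> alt_diff hs (mix w q m) z" .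
qed

lemma continuous_on_mix: "continuous_on {0..} (mix w q m)"
proof (rule uniform_limit_theorem)
  show "uniform_limit {0..} (\<lambda>N z. \<Sum>n<N. w n * (trunc_power (q n) m z / q n ^ m)) (mix w q m) sequentially"
    unfolding mix_def by (rule Weierstrass_m_test[OF _ w(2)]) (rule norm_mix_term, simp)
  show "\<forall>\<^sub>F N in sequentially. continuous_on {0..} (\<lambda>z. \<Sum>n<N. w n * (trunc_power (q n) m z / q n ^ m))"
    using q by (intro always_eventually allI continuous_intros continuous_on_trunc_power)
      (simp add: less_imp_neq[THEN not_sym])
qed simp

text \<open>Each summand vanishes eventually and is dominated by its weight, so limit and sum may be
  exchanged by Tannery's theorem.\<close>

lemma mix_tendsto_0: "(mix w q m \<longlongrightarrow> 0) at_top"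
proof -
  have "\<forall>\<^sub>F (k, z) in at_top \<times>\<^sub>F at_top. norm (w k * (trunc_power (q k) m z / q k ^ m)) \<le> w k"
  proof -
    have "\<forall>\<^sub>F (k :: nat, z :: real) in at_top \<times>\<^sub>F at_top. 0 \<le> z"
      by (subst eventually_prod2) (auto intro: eventually_ge_at_top)
    then show ?thesis by eventually_elim (use norm_mix_term in auto)
  qed
  moreover have "((\<lambda>z. w k * (trunc_power (q k) m z / q k ^ m)) \<longlongrightarrow> 0) at_top" for k
    by (intro tendsto_mult_right_zero tendsto_divide_zero trunc_power_tendsto_0 m)
  ultimately have "((\<lambda>z. \<Sum>k. w k * (trunc_power (q k) m z / q k ^ m)) \<longlongrightarrow> (\<Sum>k. 0)) at_top"
    using tannerys_theorem[where b = "\<lambda>_. 0" and M = w and F = at_top and a = "\<lambda>k z. w k * (trunc_power (q k) m z / q k ^ m)"] w(2)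
    by (metis (no_types, lifting) trivial_limit_at_top_linorder)
  then show ?thesis by (simp add: mix_def[abs_def])
qed

lemma mix_strict_antimono:
  assumes z: "0 \<le> x" "x < y" "x < q n" "0 < w n"
  shows "mix w q m y < mix w q m x"
proof -
  let ?t = "\<lambda>n z. w n * (trunc_power (q n) m z / q n ^ m)"
  have "0 < (\<Sum>n. ?t n x - ?t n y)"
  proof (rule suminf_pos2)
    show "summable (\<lambda>n. ?t n x - ?t n y)"
      using z by (intro summable_diff summable_mix) auto
    show "0 \<le> ?t k x - ?t k y" for k
      using z w(1)[of k] q[of k] trunc_power_antimono[of x y "q k" m]
      by (simp add: mult_left_mono divide_right_mono)
    have "trunc_power (q n) m y < trunc_power (q n) m x"
      unfolding trunc_power_def using z m by (intro power_strict_mono) auto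
    then show "0 < ?t n x - ?t n y" using z q[of n]
      by (simp add: mult_strict_left_mono divide_strict_right_mono)
  qed
  also have "\<dots> = mix w q m x - mix w q m y"
    unfolding mix_def using z by (intro suminf_diff[symmetric] summable_mix) auto
  finally show ?thesis by simp
qed

text \<open>Isolates the kink at \<open>q n\<close>. The remainder is again a mixture, because the
  weights may vanish and need not add up to 1.\<close>

lemma mix_split:
  assumes "0 \<le> z"
  shows "mix w q m z = w n / q n ^ m * trunc_power (q n) m z + mix (w(n := 0)) q m z"
proof -
  let ?t = "\<lambda>n. w n * (trunc_power (q n) m z / q n ^ m)"
  have sums: "(\<lambda>k. ?t k - (if k = n then ?t k else 0)) sums (mix w q m z - ?t n)"
    unfolding mix_def by (intro sums_diff summable_sums summable_mix sums_single assms)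
  have eq: "(\<lambda>k. ?t k - (if k = n then ?t k else 0)) =
      (\<lambda>k. (w(n := 0)) k * (trunc_power (q k) m z / q k ^ m))"
    by auto
  from sums have "mix w q m z - ?t n = mix (w(n := 0)) q m z"
    unfolding mix_def[of "w(n := 0)"] eq by (rule sums_unique)
  then show ?thesis by simp
qed

end

subsection \<open>Archimedean copulas and alternating generators\<close>

lemma generatorD:
  assumes "generator \<psi>"
  shows generator_range: "0 \<le> z \<Longrightarrow> 0 \<le> \<psi> z \<and> \<psi> z \<le> 1"
    and generator_continuous: "continuous_on {0..} \<psi>"
    and generator_antimono: "0 \<le> x \<Longrightarrow> x \<le> y \<Longrightarrow> \<psi> y \<le> \<psi> x"
    and generator_0: "\<psi> 0 = 1"
    and generator_tendsto: "(\<psi> \<longlongrightarrow> 0) at_top"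
    and generator_Lim: "Lim at_top \<psi> = 0"
  using assms by (auto simp: generator_def monotone_on_def image_subset_iff intro: tendsto_Lim)

text \<open>Strict monotonicity is only given below the infimum of the zeros, so a point with
  positive value must be kept strictly away from that infimum. Right-continuity supplies
  \<open>z'\<close>, and monotonicity puts all zeros beyond it. The form with \<open>gen_ext\<close>
  also serves the pseudo-inverse at 0.\<close>

lemma generator_pos_bound:
  assumes g: "generator \<psi>" and z: "0 \<le> z" "0 < \<psi> z"
  obtains z' where "z < z'" "\<And>w. gen_ext \<psi> w = 0 \<Longrightarrow> ennreal z' \<le> w"
proof -
  have "(\<psi> \<longlongrightarrow> \<psi> z) (at_right z)"
    using generator_continuous[OF g] z(1)
    by (auto simp: continuous_on_def intro: tendsto_within_subset)
  from order_tendstoD(1)[OF this z(2)] have "\<forall>\<^sub>F x in at_right z. 0 < \<psi> x" .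
  with eventually_at_right_less[of z] have "\<forall>\<^sub>F x in at_right z. z < x \<and> 0 < \<psi> x"
    by eventually_elim simp
  then obtain z' where z': "z < z'" "0 < \<psi> z'"
    using eventually_happens'[OF trivial_limit_at_right_real] by blast
  have "ennreal z' \<le> w" if "gen_ext \<psi> w = 0" for w
  proof (cases w)
    case (real v)
    then have "\<psi> v = 0" using that by (simp add: gen_ext_def)
    then have "\<not> v \<le> z'" using generator_antimono[OF g, of v z'] real z' by auto
    then show ?thesis using real by simp
  qed simp
  then show ?thesis using that z' by blast
qed

lemma generator_strict_antimono:
  assumes g: "generator \<psi>" and xy: "0 \<le> x" "x < y" "0 < \<psi> x"
  shows "\<psi> y < \<psi> x"
proof (cases "\<psi> y = 0")
  case False
  then have y: "0 \<le> y" "0 < \<psi> y" using generator_range[OF g, of y] xy by auto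
  have below: "z \<in> {x. 0 \<le> x \<and> ennreal x < Inf (ennreal ` {z. 0 \<le> z \<and> \<psi> z = 0})}"
    if z: "0 \<le> z" "0 < \<psi> z" for z
  proof -
    obtain z' where z': "z < z'" "\<And>w. gen_ext \<psi> w = 0 \<Longrightarrow> ennreal z' \<le> w"
      using generator_pos_bound[OF g z] by blast
    have "ennreal z < ennreal z'" using z z' by (simp add: ennreal_less_iff)
    also have "\<dots> \<le> Inf (ennreal ` {z. 0 \<le> z \<and> \<psi> z = 0})"
      by (rule Inf_greatest) (auto simp: gen_ext_def intro!: z'(2))
    finally show ?thesis using z by simp
  qed
  show ?thesis
    using g below[OF xy(1,3)] below[OF y] xy(2)
    unfolding generator_def monotone_on_def by blast
qed (use xy in simp)

lemma pseudo_inverse_generator: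
  assumes g: "generator \<psi>" and z: "0 \<le> z" "0 < \<psi> z"
  shows "pseudo_inverse \<psi> (\<psi> z) = ennreal z"
proof -
  have "w = ennreal z" if "gen_ext \<psi> w = \<psi> z" for w
  proof (cases w)
    case (real v)
    then have "\<psi> v = \<psi> z" using that by (simp add: gen_ext_def)
    then have "v = z"
      using generator_strict_antimono[OF g, of v z] generator_strict_antimono[OF g, of z v] real z
      by (cases v z rule: linorder_cases) auto
    then show ?thesis using real by simp
  next
    case top
    then show ?thesis using that z generator_Lim[OF g] by (simp add: gen_ext_def)
  qed
  then have "{w. gen_ext \<psi> w = \<psi> z} = {ennreal z}"
    using z by (auto simp: gen_ext_def[of _ "ennreal z"])
  then show ?thesis by (simp add: pseudo_inverse_def)
qed

text \<open>The infimum of the zeros is itself a zero: a positive value at or beyond it would force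
  the infimum strictly further to the right.\<close>

lemma gen_ext_eq_0:
  assumes g: "generator \<psi>" and w: "pseudo_inverse \<psi> 0 \<le> w"
  shows "gen_ext \<psi> w = 0"
proof (cases w)
  case (real v)
  show ?thesis
  proof (rule ccontr)
    assume "gen_ext \<psi> w \<noteq> 0"
    then have v: "0 \<le> v" "0 < \<psi> v"
      using generator_range[OF g, of v] real by (auto simp: gen_ext_def)
    obtain z' where z': "v < z'" "\<And>w. gen_ext \<psi> w = 0 \<Longrightarrow> ennreal z' \<le> w"
      using generator_pos_bound[OF g v] by blast
    have "ennreal z' \<le> pseudo_inverse \<psi> 0"
      unfolding pseudo_inverse_def by (rule Inf_greatest) (auto intro: z'(2))
    also have "\<dots> \<le> ennreal v" using w real by simp
    finally show False using z' v by simp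
  qed
qed (simp add: gen_ext_def generator_Lim[OF g])

lemma archimedean_eq_0:
  assumes g: "generator \<psi>" and u: "u \<in> cube d" "i < d" "u i = 0"
  shows "archimedean d \<psi> u = 0"
proof -
  have "pseudo_inverse \<psi> (u i) \<le> (\<Sum>i<d. pseudo_inverse \<psi> (u i))"
    using u by (intro member_le_sum) auto
  then show ?thesis using u by (simp add: archimedean_def gen_ext_eq_0[OF g])
qed

lemma cube_generator:
  assumes g: "generator \<psi>" and z: "\<And>i. i < d \<Longrightarrow> 0 \<le> z i"
  shows "(\<lambda>i\<in>{..<d}. \<psi> (z i)) \<in> cube d"
  unfolding cube_def using z generator_range[OF g] by (intro restrict_PiE_iff[THEN iffD2]) auto

text \<open>Removes the pseudo-inverse from later arguments. Where some \<open>\<psi> (z i)\<close>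
  is 0 the pseudo-inverse need not return \<open>z i\<close>, but then both sides are 0.\<close>

lemma archimedean_generator:
  assumes g: "generator \<psi>" and z: "\<And>i. i < d \<Longrightarrow> 0 \<le> z i"
  shows "archimedean d \<psi> (\<lambda>i\<in>{..<d}. \<psi> (z i)) = \<psi> (\<Sum>i<d. z i)"
proof (cases "\<exists>i<d. \<psi> (z i) = 0")
  case True
  then obtain i where i: "i < d" "\<psi> (z i) = 0" by blast
  have "z i \<le> (\<Sum>i<d. z i)" using i z by (intro member_le_sum) auto
  then have "\<psi> (\<Sum>i<d. z i) = 0"
    using generator_antimono[OF g, of "z i" "\<Sum>i<d. z i"] generator_range[OF g, of "\<Sum>i<d. z i"] i z[OF i(1)]
    by auto
  then show ?thesis using archimedean_eq_0[OF g cube_generator[OF g z]] i by simp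
next
  case False
  then have "pseudo_inverse \<psi> (\<psi> (z i)) = ennreal (z i)" if "i < d" for i
    using pseudo_inverse_generator[OF g z[OF that]] generator_range[OF g z[OF that]] that
    by (metis order_le_less)
  then have eq: "(\<Sum>i<d. pseudo_inverse \<psi> ((\<lambda>i\<in>{..<d}. \<psi> (z i)) i)) = ennreal (\<Sum>i<d. z i)"
    using z by (subst sum_ennreal[symmetric]) auto
  have "(\<lambda>i\<in>{..<d}. \<psi> (z i)) \<in> cube d" using z by (rule cube_generator[OF g])
  then have "archimedean d \<psi> (\<lambda>i\<in>{..<d}. \<psi> (z i)) = gen_ext \<psi> (ennreal (\<Sum>i<d. z i))"
    unfolding archimedean_def eq[symmetric] by (rule restrict_apply')
  moreover have "0 \<le> (\<Sum>i<d. z i)" using z by (intro sum_nonneg) auto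
  ultimately show ?thesis by (simp add: gen_ext_def)
qed

lemma generator_surj:
  assumes g: "generator \<psi>" and u: "0 < u" "u \<le> 1"
  shows "\<exists>z\<ge>0. \<psi> z = u"
proof -
  have "\<forall>\<^sub>F b in at_top. \<psi> b < u" using order_tendstoD(2)[OF generator_tendsto[OF g] u(1)] .
  with eventually_ge_at_top[of 0] have "\<forall>\<^sub>F b in at_top. 0 \<le> b \<and> \<psi> b < u"
    by eventually_elim simp
  then obtain b where b: "0 \<le> b" "\<psi> b < u"
    using eventually_happens'[OF trivial_limit_at_top_linorder] by blast
  have "\<exists>z\<ge>0. z \<le> b \<and> \<psi> z = u"
    using b u generator_0[OF g] continuous_on_subset[OF generator_continuous[OF g], of "{0..b}"]
    by (intro IVT2') auto
  then show ?thesis by blast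
qed

lemma cube_generatorE:
  assumes g: "generator \<psi>" and u: "u \<in> cube d" "\<And>i. i < d \<Longrightarrow> 0 < u i"
  obtains z where "\<And>i. 0 \<le> z i" "\<And>i. i < d \<Longrightarrow> \<psi> (z i) = u i" "u = (\<lambda>i\<in>{..<d}. \<psi> (z i))"
proof -
  have "\<exists>z\<ge>0. i < d \<longrightarrow> \<psi> z = u i" for i
    using generator_surj[OF g, of "u i"] u by (cases "i < d") (auto simp: cube_def PiE_iff)
  then obtain z where z: "\<And>i. 0 \<le> z i" "\<And>i. i < d \<Longrightarrow> \<psi> (z i) = u i" by metis
  have "u = (\<lambda>i\<in>{..<d}. \<psi> (z i))"
    using u(1) z(2) by (auto simp: cube_def PiE_iff extensional_def)
  then show ?thesis using that z by blast
qed

section \<open>Box volumes as finite differences of the generator\<close>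

lemma alt_diff_snoc: "alt_diff (hs @ [h]) f z = alt_diff hs f z - alt_diff hs f (z + h)"
  by (induction hs arbitrary: z) (simp_all add: ac_simps)

text \<open>Gives the iterated difference the inclusion-exclusion form of
  \<open>d_increasing\<close>. The induction splits the subsets by whether they contain the last
  index.\<close>

lemma alt_diff_eq_sum:
  "alt_diff (map h [0..<d]) f z = (\<Sum>S\<in>Pow {..<d}. (- 1) ^ card S * f (z + (\<Sum>i\<in>S. h i)))"
proof (induction d arbitrary: z)
  case (Suc d)
  have inj: "inj_on (insert d) (Pow {..<d})"
    by (rule inj_onI) (metis insert_ident lessThan_iff less_irrefl subsetD PowD)
  have "(\<Sum>S\<in>Pow {..<Suc d}. (- 1) ^ card S * f (z + (\<Sum>i\<in>S. h i))) =
      (\<Sum>S\<in>Pow {..<d}. (- 1) ^ card S * f (z + (\<Sum>i\<in>S. h i))) +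
      (\<Sum>S\<in>insert d ` Pow {..<d}. (- 1) ^ card S * f (z + (\<Sum>i\<in>S. h i)))"
    unfolding lessThan_Suc Pow_insert by (rule sum.union_disjoint) auto
  also have "(\<Sum>S\<in>insert d ` Pow {..<d}. (- 1) ^ card S * f (z + (\<Sum>i\<in>S. h i))) =
      (\<Sum>S\<in>Pow {..<d}. - ((- 1) ^ card S * f (z + h d + (\<Sum>i\<in>S. h i))))"
    unfolding sum.reindex[OF inj] o_def
  proof (rule sum.cong[OF refl])
    fix S assume "S \<in> Pow {..<d}"
    then have "finite S" "d \<notin> S" by (auto intro: finite_subset)
    then show "(- 1) ^ card (insert d S) * f (z + (\<Sum>i\<in>insert d S. h i)) =
        - ((- 1) ^ card S * f (z + h d + (\<Sum>i\<in>S. h i)))"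
      by (simp add: add.assoc)
  qed
  finally show ?case by (simp add: alt_diff_snoc Suc.IH sum_negf)
qed simp

lemma sum_if_mem:
  fixes x y :: "nat \<Rightarrow> real"
  assumes "S \<subseteq> {..<d}"
  shows "(\<Sum>i<d. if i \<in> S then x i else y i) = (\<Sum>i<d. y i) + (\<Sum>i\<in>S. x i - y i)"
proof -
  have "(\<Sum>i\<in>S. x i - y i) = (\<Sum>i<d. if i \<in> S then x i - y i else 0)"
    using assms by (simp add: sum.inter_restrict[symmetric] Int_absorb1)
  then show ?thesis by (simp add: sum.distrib[symmetric] if_distrib cong: if_cong sum.cong)
qed

text \<open>As \<open>\<psi>\<close> decreases, the lower corner of the box has the larger
  parameters \<open>x\<close>; the steps are the side lengths in the parameters.\<close>

lemma archimedean_volume: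
  assumes g: "generator \<psi>" and x: "\<And>i. i < d \<Longrightarrow> 0 \<le> x i" and y: "\<And>i. i < d \<Longrightarrow> 0 \<le> y i"
  shows "(\<Sum>S\<in>Pow {..<d}. (- 1) ^ card S *
      archimedean d \<psi> (\<lambda>i\<in>{..<d}. if i \<in> S then \<psi> (x i) else \<psi> (y i))) =
    alt_diff (map (\<lambda>i. x i - y i) [0..<d]) \<psi> (\<Sum>i<d. y i)"
  unfolding alt_diff_eq_sum
proof (rule sum.cong[OF refl])
  fix S assume S: "S \<in> Pow {..<d}"
  have "archimedean d \<psi> (\<lambda>i\<in>{..<d}. \<psi> (if i \<in> S then x i else y i)) = \<psi> (\<Sum>i<d. if i \<in> S then x i else y i)"
    using x y by (intro archimedean_generator[OF g]) auto
  then show "(- 1) ^ card S * archimedean d \<psi> (\<lambda>i\<in>{..<d}. if i \<in> S then \<psi> (x i) else \<psi> (y i)) =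
      (- 1) ^ card S * \<psi> ((\<Sum>i<d. y i) + (\<Sum>i\<in>S. x i - y i))"
    using S by (simp add: sum_if_mem if_distrib[of \<psi>])
qed

lemma copula_imp_alternating:
  assumes g: "generator \<psi>" and C: "copula d (archimedean d \<psi>)" and d: "0 < d"
  shows "alternating {0..} d \<psi>"
proof (rule alternatingI_tendsto_0[OF generator_tendsto[OF g]])
  fix hs :: "real list" and z :: real
  assume hs: "length hs = d" "\<forall>h\<in>set hs. 0 \<le> h" and z: "0 \<le> z"
  \<comment> \<open>Splitting \<open>z\<close> evenly over the coordinates gives a box whose volume
    is exactly the difference with base point \<open>z\<close> and steps \<open>hs\<close>.\<close>
  define y where "y i = z / d" for i :: nat
  define x where "x i = z / d + hs ! i" for i
  have xy: "0 \<le> y i" "0 \<le> x i" "y i \<le> x i" if "i < d" for i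
    using that hs z by (auto simp: x_def y_def)
  let ?a = "\<lambda>i\<in>{..<d}. \<psi> (x i)" and ?b = "\<lambda>i\<in>{..<d}. \<psi> (y i)"
  have "?a \<in> cube d" "?b \<in> cube d" using xy by (auto intro!: cube_generator[OF g])
  moreover have "\<forall>i<d. ?a i \<le> ?b i" using xy generator_antimono[OF g] by auto
  ultimately have "0 \<le> (\<Sum>S\<in>Pow {..<d}. (- 1) ^ card S * archimedean d \<psi> (\<lambda>i. if i \<in> S then ?a i else ?b i))"
    using C unfolding copula_def d_increasing_def by blast
  also have "\<dots> = (\<Sum>S\<in>Pow {..<d}. (- 1) ^ card S *
      archimedean d \<psi> (\<lambda>i\<in>{..<d}. if i \<in> S then \<psi> (x i) else \<psi> (y i)))"
    by (intro sum.cong refl arg_cong2[where f = "(*)"] arg_cong[where f = "archimedean d \<psi>"]) auto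
  also have "\<dots> = alt_diff (map (\<lambda>i. x i - y i) [0..<d]) \<psi> (\<Sum>i<d. y i)"
    using xy by (intro archimedean_volume[OF g]) auto
  also have "map (\<lambda>i. x i - y i) [0..<d] = hs"
    using hs by (auto simp: x_def y_def intro: nth_equalityI)
  also have "(\<Sum>i<d. y i) = z" using d by (simp add: y_def)
  finally show "0 \<le> alt_diff hs \<psi> z" .
qed

lemma archimedean_range:
  assumes g: "generator \<psi>" and u: "u \<in> cube d" "i < d"
  shows "0 \<le> archimedean d \<psi> u" "archimedean d \<psi> u \<le> u i"
proof -
  have "0 \<le> archimedean d \<psi> u \<and> archimedean d \<psi> u \<le> u i"
  proof (cases "\<exists>j<d. u j = 0")
    case True
    then show ?thesis using archimedean_eq_0[OF g u(1)] u by (auto simp: cube_def PiE_iff)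
  next
    case False
    then have "0 < u j" if "j < d" for j
      using u(1) that by (force simp: cube_def PiE_iff order_less_le)
    then obtain z where z: "\<And>i. 0 \<le> z i" "\<And>i. i < d \<Longrightarrow> \<psi> (z i) = u i" "u = (\<lambda>i\<in>{..<d}. \<psi> (z i))"
      using cube_generatorE[OF g u(1)] by blast
    have "archimedean d \<psi> u = \<psi> (\<Sum>i<d. z i)"
      using archimedean_generator[OF g, of d z] z(1) by (subst z(3)) simp
    moreover have "z i \<le> (\<Sum>i<d. z i)" using u z by (intro member_le_sum) auto
    ultimately show ?thesis
      using generator_antimono[OF g, of "z i" "\<Sum>i<d. z i"] z(1) z(2)[OF u(2)]
        generator_range[OF g, of "\<Sum>i<d. z i"] by (auto simp: sum_nonneg)
  qed
  then show "0 \<le> archimedean d \<psi> u" "archimedean d \<psi> u \<le> u i" by auto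
qed

text \<open>Lets boxes with a vertex on a coordinate hyperplane, where the pseudo-inverse may be infinite,
  be approximated by boxes with positive coordinates.\<close>

lemma archimedean_tendsto:
  assumes g: "generator \<psi>" and u: "u \<in> cube d"
  shows "((\<lambda>t. archimedean d \<psi> (\<lambda>i\<in>{..<d}. max t (u i))) \<longlongrightarrow> archimedean d \<psi> u) (at_right 0)"
proof (cases "\<exists>i<d. u i = 0")
  case True
  then obtain i where i: "i < d" "u i = 0" by blast
  have ev: "\<forall>\<^sub>F t in at_right 0. (\<lambda>i\<in>{..<d}. max t (u i)) \<in> cube d"
    unfolding eventually_at_right_field using u
    by (intro exI[of _ 1]) (auto simp: cube_def PiE_iff)
  have "((\<lambda>t. archimedean d \<psi> (\<lambda>i\<in>{..<d}. max t (u i))) \<longlongrightarrow> 0) (at_right 0)"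
  proof (rule tendsto_sandwich[OF _ _ tendsto_const])
    show "\<forall>\<^sub>F t in at_right 0. 0 \<le> archimedean d \<psi> (\<lambda>i\<in>{..<d}. max t (u i))"
      using ev by eventually_elim (use archimedean_range(1)[OF g _ i(1)] in blast)
    show "\<forall>\<^sub>F t in at_right 0. archimedean d \<psi> (\<lambda>i\<in>{..<d}. max t (u i)) \<le> max t 0"
      using ev by eventually_elim (use archimedean_range(2)[OF g _ i(1)] i in fastforce)
    have "((\<lambda>t::real. max t 0) \<longlongrightarrow> max 0 0) (at_right 0)" by (intro tendsto_intros)
    then show "((\<lambda>t::real. max t 0) \<longlongrightarrow> 0) (at_right 0)" by simp
  qed
  then show ?thesis using archimedean_eq_0[OF g u i] by simp
next
  case False
  have "\<forall>\<^sub>F t in at_right 0. \<forall>i\<in>{..<d}. t < u i"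
  proof (intro eventually_ball_finite ballI)
    fix i assume "i \<in> {..<d}"
    then have "0 < u i" using False u by (force simp: cube_def PiE_iff order_less_le)
    then show "\<forall>\<^sub>F t in at_right 0. t < u i"
      by (auto simp: eventually_at_right_field)
  qed simp
  then have "\<forall>\<^sub>F t in at_right 0. archimedean d \<psi> (\<lambda>i\<in>{..<d}. max t (u i)) = archimedean d \<psi> u"
  proof eventually_elim
    case (elim t)
    then have "(\<lambda>i\<in>{..<d}. max t (u i)) = u"
      using u by (auto simp: cube_def PiE_iff extensional_def restrict_def fun_eq_iff max_absorb2 less_imp_le)
    then show ?case by simp
  qed
  then show ?thesis by (rule tendsto_eventually)
qed

text \<open>Raising all coordinates to at least \<open>t\<close>, with \<open>0 < t < 1\<close>,
  gives a box whose corners have finite preimages, so its volume is an alternating difference. Then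
  \<open>t\<close> tends to 0.\<close>

lemma d_increasing_archimedean:
  assumes g: "generator \<psi>" and alt: "alternating {0..} d \<psi>"
  shows "d_increasing d (archimedean d \<psi>)"
  unfolding d_increasing_def
proof (intro ballI impI)
  fix a b assume ab: "a \<in> cube d" "b \<in> cube d" "\<forall>i<d. a i \<le> b i"
  let ?C = "archimedean d \<psi>"
  let ?u = "\<lambda>t S. \<lambda>i\<in>{..<d}. if i \<in> S then max t (a i) else max t (b i)"
  have "((\<lambda>t. \<Sum>S\<in>Pow {..<d}. (- 1) ^ card S * ?C (?u t S)) \<longlongrightarrow>
      (\<Sum>S\<in>Pow {..<d}. (- 1) ^ card S * ?C (\<lambda>i. if i \<in> S then a i else b i))) (at_right 0)"
  proof (intro tendsto_sum tendsto_mult_left)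
    fix S assume "S \<in> Pow {..<d}"
    then have "(\<lambda>i. if i \<in> S then a i else b i) \<in> cube d"
      using ab by (auto simp: cube_def PiE_iff extensional_def)
    from archimedean_tendsto[OF g this]
    show "((\<lambda>t. ?C (?u t S)) \<longlongrightarrow> ?C (\<lambda>i. if i \<in> S then a i else b i)) (at_right 0)"
      by (simp add: if_distrib[of "max _"])
  qed
  moreover have "\<forall>\<^sub>F t in at_right 0. 0 \<le> (\<Sum>S\<in>Pow {..<d}. (- 1) ^ card S * ?C (?u t S))"
    unfolding eventually_at_right_field
  proof (intro exI[of _ 1] conjI allI impI)
    fix t :: real assume t: "0 < t" "t < 1"
    have "(\<lambda>i\<in>{..<d}. max t (a i)) \<in> cube d" "(\<lambda>i\<in>{..<d}. max t (b i)) \<in> cube d"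
      using ab t by (auto simp: cube_def PiE_iff)
    note cubes = this
    obtain x where x: "\<And>i. 0 \<le> x i" "\<And>i. i < d \<Longrightarrow> \<psi> (x i) = max t (a i)"
    proof -
      have pos: "0 < (\<lambda>i\<in>{..<d}. max t (a i)) i" if "i < d" for i using t that by simp
      from cube_generatorE[OF g cubes(1) pos] show ?thesis
        using that by (metis (no_types, lifting) lessThan_iff restrict_apply')
    qed
    obtain y where y: "\<And>i. 0 \<le> y i" "\<And>i. i < d \<Longrightarrow> \<psi> (y i) = max t (b i)"
    proof -
      have pos: "0 < (\<lambda>i\<in>{..<d}. max t (b i)) i" if "i < d" for i using t that by simp
      from cube_generatorE[OF g cubes(2) pos] show ?thesis
        using that by (metis (no_types, lifting) lessThan_iff restrict_apply')
    qed
    have xy: "y i \<le> x i" if "i < d" for i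
    proof (rule ccontr)
      assume "\<not> y i \<le> x i"
      then have "\<psi> (y i) < \<psi> (x i)"
        using generator_strict_antimono[OF g, of "x i" "y i"] x that t by auto
      then show False using x y ab that by auto
    qed
    have "0 \<le> alt_diff (map (\<lambda>i. x i - y i) [0..<d]) \<psi> (\<Sum>i<d. y i)"
      using xy y by (intro alternatingD[OF alt]) (auto simp: sum_nonneg)
    also have "\<dots> = (\<Sum>S\<in>Pow {..<d}. (- 1) ^ card S *
      archimedean d \<psi> (\<lambda>i\<in>{..<d}. if i \<in> S then \<psi> (x i) else \<psi> (y i)))"
      using x y by (intro archimedean_volume[OF g, symmetric])
    also have "\<dots> = (\<Sum>S\<in>Pow {..<d}. (- 1) ^ card S * ?C (?u t S))"
      using x y by (intro sum.cong refl arg_cong2[where f = "(*)"] arg_cong[where f = "archimedean d \<psi>"]) auto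
    finally show "0 \<le> (\<Sum>S\<in>Pow {..<d}. (- 1) ^ card S * ?C (?u t S))" .
  qed simp
  ultimately show "0 \<le> (\<Sum>S\<in>Pow {..<d}. (- 1) ^ card S * ?C (\<lambda>i. if i \<in> S then a i else b i))"
    by (rule tendsto_lowerbound) simp
qed

lemma alternating_imp_copula:
  assumes g: "generator \<psi>" and alt: "alternating {0..} d \<psi>" and d: "0 < d"
  shows "copula d (archimedean d \<psi>)"
  unfolding copula_def
proof (intro conjI ballI allI impI d_increasing_archimedean[OF g alt])
  have "archimedean d \<psi> u \<in> {0..1}" if "u \<in> cube d" for u
    using archimedean_range[OF g that d] that d by (force simp: cube_def PiE_iff)
  then show "archimedean d \<psi> \<in> cube d \<rightarrow>\<^sub>E {0..1}"
    by (auto simp: PiE_iff archimedean_def[abs_def])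
next
  fix u assume "u \<in> cube d" "\<exists>i<d. u i = 0"
  then show "archimedean d \<psi> u = 0" using archimedean_eq_0[OF g] by blast
next
  fix u i assume u: "u \<in> cube d" and i: "i < d" and 1: "\<forall>j<d. j \<noteq> i \<longrightarrow> u j = 1"
  show "archimedean d \<psi> u = u i"
  proof (cases "u i = 0")
    case True
    then show ?thesis using archimedean_eq_0[OF g u i] by simp
  next
    case False
    then have "0 < u i" "u i \<le> 1" using u i by (force simp: cube_def PiE_iff order_less_le)+
    then obtain z where z: "0 \<le> z" "\<psi> z = u i" using generator_surj[OF g] by blast
    define x where "x j = (if j = i then z else 0)" for j
    have "u = (\<lambda>j\<in>{..<d}. \<psi> (x j))"
      using u z 1 generator_0[OF g] by (auto simp: x_def cube_def PiE_iff extensional_def)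
    moreover have "archimedean d \<psi> (\<lambda>j\<in>{..<d}. \<psi> (x j)) = \<psi> (\<Sum>j<d. x j)"
      using z by (intro archimedean_generator[OF g]) (simp add: x_def)
    moreover have "(\<Sum>j<d. x j) = z" using i by (simp add: x_def)
    ultimately show ?thesis using z by simp
  qed
qed

subsection \<open>Iterated partial derivatives at kinks\<close>

text \<open>Each coordinate is parametrised by \<open>\<psi>\<close>, so that the chain rule only involves \<open>\<psi>\<close> and no
  differentiability of its inverse is needed.\<close>

lemma has_iterated_partial_Cons_archimedean:
  assumes g: "generator \<psi>" and z: "\<And>j. j < d \<Longrightarrow> 0 < z j" and i: "i < d" "i \<notin> set is"
    and p: "(\<psi> has_real_derivative p) (at (z i))"
    and D: "has_iterated_partial (i # is) (archimedean d \<psi>) (\<lambda>j\<in>{..<d}. \<psi> (z j)) D"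
    and inner: "\<And>y E. (\<And>j. j < d \<Longrightarrow> 0 < y j) \<Longrightarrow> (\<And>j. j \<in> set is \<Longrightarrow> y j = z j) \<Longrightarrow>
      has_iterated_partial is (archimedean d \<psi>) (\<lambda>j\<in>{..<d}. \<psi> (y j)) E \<Longrightarrow> E * P = F (\<Sum>j<d. y j)"
  shows "(F has_real_derivative D * p * P) (at (\<Sum>j<d. z j))"
proof -
  let ?u = "\<lambda>j\<in>{..<d}. \<psi> (z j)"
  obtain f e where e: "e > 0"
      "\<And>t. t \<in> {0..1} \<Longrightarrow> dist t (\<psi> (z i)) < e \<Longrightarrow> has_iterated_partial is (archimedean d \<psi>) (?u(i := t)) (f t)"
    and f: "(f has_real_derivative D) (at (\<psi> (z i)) within {0..1})"
  proof -
    have "?u i = \<psi> (z i)" using i by simp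
    with D show ?thesis unfolding has_iterated_partial.simps using that by metis
  qed
  have "\<psi> ` {0<..} \<subseteq> {0..1}" using generator_range[OF g] by force
  \<comment> \<open>The derivative within the unit interval is restricted to the image of
    \<open>\<psi>\<close>; the composite then has a two-sided derivative at the interior point
    \<open>z i\<close>.\<close>
  then have "(f has_real_derivative D) (at (\<psi> (z i)) within \<psi> ` {0<..})"
    by (rule DERIV_subset[OF f])
  moreover have zi: "at (z i) within {0<..} = at (z i)"
    using z[OF i(1)] by (intro at_within_open) auto
  ultimately have "(f \<circ> \<psi> has_real_derivative D * p) (at (z i))"
    using DERIV_image_chain[of f D \<psi> "z i" "{0<..}" p] p by simp
  from DERIV_cmult_right[OF this, of P]
  have 1: "((\<lambda>s. f (\<psi> s) * P) has_real_derivative D * p * P) (at (z i))" by (simp add: o_def)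
  \<comment> \<open>With the other parameters fixed, the argument of \<open>F\<close> is the
    translate \<open>s + c\<close> of the moving parameter.\<close>
  define c where "c = (\<Sum>j<d. z j) - z i"
  have "\<forall>\<^sub>F s in at (z i). dist (\<psi> s) (\<psi> (z i)) < e"
    using DERIV_isCont[OF p] e(1) by (auto simp: isCont_def dest: tendstoD)
  \<comment> \<open>The identity between the two functions is needed at \<open>z i\<close> itself as
    well, hence \<open>nhds\<close> instead of \<open>at\<close>.\<close>
  then have "\<forall>\<^sub>F s in nhds (z i). dist (\<psi> s) (\<psi> (z i)) < e"
    using e(1) by (simp add: eventually_nhds_conv_at)
  moreover have "\<forall>\<^sub>F s in nhds (z i). 0 < s"
    using z[OF i(1)] by (intro eventually_nhds_in_open[of "{0<..}", simplified]) auto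
  ultimately have ev: "\<forall>\<^sub>F s in nhds (z i). f (\<psi> s) * P = F (s + c)"
  proof eventually_elim
    case (elim s)
    have "?u(i := \<psi> s) = (\<lambda>j\<in>{..<d}. \<psi> ((z(i := s)) j))" using i by auto
    moreover have "has_iterated_partial is (archimedean d \<psi>) (?u(i := \<psi> s)) (f (\<psi> s))"
      using elim generator_range[OF g, of s] by (intro e(2)) auto
    moreover have "(\<Sum>j<d. (z(i := s)) j) = s + c"
    proof -
      have "(\<Sum>j<d. (z(i := s)) j) = s + (\<Sum>j\<in>{..<d} - {i}. z j)"
        using i by (subst sum.remove[of _ i]) auto
      also have "(\<Sum>j\<in>{..<d} - {i}. z j) = c"
        using i by (simp add: c_def sum.remove[of "{..<d}" i])
      finally show ?thesis .
    qed
    moreover have "f (\<psi> s) * P = F (\<Sum>j<d. (z(i := s)) j)"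
    proof (rule inner)
      show "has_iterated_partial is (archimedean d \<psi>) (\<lambda>j\<in>{..<d}. \<psi> ((z(i := s)) j)) (f (\<psi> s))"
        using calculation by simp
    qed (use z elim i in auto)
    ultimately show ?case by simp
  qed
  from 1 have "((\<lambda>s. F (s + c)) has_real_derivative D * p * P) (at (z i))"
    by (rule DERIV_cong_ev[OF refl ev refl, THEN iffD1])
  then have "(F has_real_derivative D * p * P) (at (z i + c))"
    by (simp add: DERIV_shift)
  then show ?thesis by (simp add: c_def)
qed

text \<open>The usual formula for mixed partials has the derivatives \<open>p j\<close> of
  \<open>\<psi>\<close> in the denominator. Multiplying them out avoids asking that they be nonzero.
  In the induction only coordinates not yet differentiated are moved, so the factors
  \<open>p j\<close> stay fixed.\<close>

lemma has_iterated_partial_archimedean: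
  assumes g: "generator \<psi>" and F0: "\<And>z. 0 < z \<Longrightarrow> F 0 z = \<psi> z"
    and F: "\<And>j z. j < m \<Longrightarrow> 0 < z \<Longrightarrow> (F j has_real_derivative F (Suc j) z) (at z)" and d: "0 < d"
  shows "distinct is \<Longrightarrow> set is \<subseteq> {..<d} \<Longrightarrow> length is \<le> m \<Longrightarrow> (\<And>j. j < d \<Longrightarrow> 0 < z j) \<Longrightarrow>
    (\<And>j. j \<in> set is \<Longrightarrow> (\<psi> has_real_derivative p j) (at (z j))) \<Longrightarrow>
    has_iterated_partial is (archimedean d \<psi>) (\<lambda>j\<in>{..<d}. \<psi> (z j)) D \<Longrightarrow>
    D * (\<Prod>j\<in>set is. p j) = F (length is) (\<Sum>j<d. z j)"
proof (induction "is" arbitrary: z D)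
  case Nil
  have "archimedean d \<psi> (\<lambda>j\<in>{..<d}. \<psi> (z j)) = \<psi> (\<Sum>j<d. z j)"
    using Nil(4) by (intro archimedean_generator[OF g]) (auto intro: less_imp_le)
  moreover have "0 < (\<Sum>j<d. z j)" using Nil(4) d by (intro sum_pos) auto
  moreover have "archimedean d \<psi> (\<lambda>j\<in>{..<d}. \<psi> (z j)) = D"
    using Nil(6) by (simp only: has_iterated_partial.simps)
  ultimately show ?case using F0 by simp
next
  case (Cons i "is")
  have pos: "0 < (\<Sum>j<d. z j)" using Cons.prems(4) d by (intro sum_pos) auto
  have "(F (length is) has_real_derivative D * p i * (\<Prod>j\<in>set is. p j)) (at (\<Sum>j<d. z j))"
  proof (rule has_iterated_partial_Cons_archimedean[OF g Cons.prems(4) _ _ _ Cons.prems(6)])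
    fix y E assume y: "\<And>j. j < d \<Longrightarrow> 0 < y j" "\<And>j. j \<in> set is \<Longrightarrow> y j = z j"
      and E: "has_iterated_partial is (archimedean d \<psi>) (\<lambda>j\<in>{..<d}. \<psi> (y j)) E"
    show "E * (\<Prod>j\<in>set is. p j) = F (length is) (\<Sum>j<d. y j)"
      using Cons.prems(1-3,5) y by (intro Cons.IH[OF _ _ _ _ _ E]) auto
  qed (use Cons.prems in auto)
  moreover have "(F (length is) has_real_derivative F (Suc (length is)) (\<Sum>j<d. z j)) (at (\<Sum>j<d. z j))"
    using F pos Cons.prems(3) by simp
  ultimately show ?case
    using DERIV_unique Cons.prems(1) by (fastforce simp: mult.assoc)
qed

text \<open>The even function \<open>f (x + h) + f (x - h)\<close> of \<open>h\<close> has
  derivative 0 at 0.\<close>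

lemma second_difference_quotient_tendsto_0:
  fixes f :: "real \<Rightarrow> real"
  assumes "(f has_real_derivative D) (at x)"
  shows "((\<lambda>h. (f (x + h) + f (x - h) - 2 * f x) / h) \<longlongrightarrow> 0) (at 0)"
proof -
  have f: "(f has_real_derivative D) (at (x + 0))" "(f has_real_derivative D) (at (x - 0))"
    using assms by simp_all
  have "((\<lambda>h. x + h) has_real_derivative 1) (at 0)" "((\<lambda>h. x - h) has_real_derivative - 1) (at 0)"
    by (auto intro!: derivative_eq_intros)
  from DERIV_add[OF DERIV_chain2[OF f(1) this(1)] DERIV_chain2[OF f(2) this(2)]]
  have "((\<lambda>h. f (x + h) + f (x - h)) has_real_derivative 0) (at 0)" by simp
  then show ?thesis by (simp add: DERIV_def)
qed

text \<open>Up to the sign \<open>(- 1) ^ m\<close>, the truncated power contributes exactly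
  \<open>c\<close> to the symmetric second difference quotient at \<open>q\<close>, and the convex
  remainder contributes something nonnegative. The quotient therefore cannot tend to 0.\<close>

lemma not_has_real_derivative_kink:
  fixes r :: "real \<Rightarrow> real"
  assumes q: "0 < q" and c: "0 < c" and r: "alternating {0<..} 2 (\<lambda>z. (- 1) ^ m * r z)"
  shows "\<not> ((\<lambda>z. c * (- 1) ^ m * trunc_power q 1 z + r z) has_real_derivative D) (at q)"
proof
  let ?f = "\<lambda>z. c * (- 1) ^ m * trunc_power q 1 z + r z"
  assume "(?f has_real_derivative D) (at q)"
  from tendsto_mult_left[OF second_difference_quotient_tendsto_0[OF this], of "(- 1) ^ m"]
  have "((\<lambda>h. (- 1) ^ m * ((?f (q + h) + ?f (q - h) - 2 * ?f q) / h)) \<longlongrightarrow> 0) (at_right 0)"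
    by (auto intro: tendsto_within_subset)
  moreover have "\<forall>\<^sub>F h in at_right 0. c \<le> (- 1) ^ m * ((?f (q + h) + ?f (q - h) - 2 * ?f q) / h)"
    unfolding eventually_at_right_field
  proof (intro exI[of _ q] conjI allI impI q)
    fix h assume h: "0 < h" "h < q"
    define e :: real where "e = (- 1) ^ m"
    have e: "e * e = 1" by (simp add: e_def flip: power_mult_distrib)
    have "0 \<le> e * r (q - h) - e * r q - (e * r q - e * r (q + h))"
      using alt_diff_monotone_step[OF r, of "q - h" h h] h by (simp add: e_def)
    moreover have "e * (?f (q + h) + ?f (q - h) - 2 * ?f q) =
        c * h * (e * e) + (e * r (q - h) - e * r q - (e * r q - e * r (q + h)))"
      using h by (simp add: trunc_power_def e_def[symmetric]) (simp add: algebra_simps)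
    ultimately have "c * h \<le> (- 1) ^ m * (?f (q + h) + ?f (q - h) - 2 * ?f q)"
      unfolding e by (simp add: e_def)
    then show "c \<le> (- 1) ^ m * ((?f (q + h) + ?f (q - h) - 2 * ?f q) / h)"
      using h by (simp add: pos_le_divide_eq)
  qed
  ultimately have "c \<le> 0" by (rule tendsto_lowerbound) simp
  with c show False by simp
qed

text \<open>The inner \<open>d - 2\<close> partial derivatives follow the smooth formula, and the
  outermost one would differentiate the derivative of order \<open>d - 2\<close> of
  \<open>\<psi>\<close> at the sum of the parameters, which is the kink.\<close>

lemma not_has_iterated_partial_archimedean:
  assumes g: "generator \<psi>" and d: "2 \<le> d" and c: "0 < c"
    and \<psi>: "\<And>z. 0 < z \<Longrightarrow> \<psi> z = c * trunc_power (\<Sum>i<d. z' i) (d - 1) z + \<rho> z"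
    and \<rho>: "continuous_on {0<..} \<rho>" "alternating {0<..} d \<rho>"
    and z: "\<And>i. i < d \<Longrightarrow> 0 < z' i" and diff: "\<And>i. i < d - 1 \<Longrightarrow> \<psi> differentiable at (z' i)"
  shows "\<not> has_iterated_partial [0..<d - 1] (archimedean d \<psi>) (\<lambda>i\<in>{..<d}. \<psi> (z' i)) D"
proof
  assume D: "has_iterated_partial [0..<d - 1] (archimedean d \<psi>) (\<lambda>i\<in>{..<d}. \<psi> (z' i)) D"
  define m where "m = d - 2"
  have dm: "d = Suc (Suc m)" using d by (simp add: m_def)
  let ?q = "\<Sum>i<d. z' i"
  have q: "0 < ?q" using z by (intro sum_pos) (auto simp: dm)
  obtain R where R: "R 0 = \<rho>" "\<And>j z. j < m \<Longrightarrow> 0 < z \<Longrightarrow> (R j has_real_derivative R (Suc j) z) (at z)"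
    "alternating {0<..} 2 (\<lambda>z. (- 1) ^ m * R m z)"
    using alternating_derivatives[OF \<rho>(1), of m] \<rho>(2) dm by auto
  \<comment> \<open>The signed falling factorial produced by differentiating \<open>c\<close> times
    the truncated power \<open>j\<close> times. Thus \<open>F j\<close> is the derivative of order
    \<open>j\<close> of \<open>\<psi>\<close> on the positive axis, for
    \<open>j \<le> m\<close>.\<close>
  define a where "a j = c * (fact (Suc m) / fact (Suc m - j)) * (- 1) ^ j" for j
  define F where "F j z = a j * trunc_power ?q (Suc m - j) z + R j z" for j z
  have F0: "F 0 z = \<psi> z" if "0 < z" for z
    using that by (simp add: F_def a_def \<psi> R(1) dm)
  have F: "(F j has_real_derivative F (Suc j) z) (at z)" if j: "j < m" and "0 < z" for j z
  proof -
    obtain k where k: "m = Suc (j + k)" using j less_imp_Suc_add by blast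
    then have mj: "Suc m - j = Suc (Suc k)" "Suc m - Suc j = Suc k" by simp_all
    have "(fact (Suc (Suc k)) :: real) = real (Suc (Suc k)) * fact (Suc k)" by (simp only: fact_Suc)
    then have a: "a j * (- real (Suc (Suc k))) = a (Suc j)"
      unfolding a_def mj by (simp del: fact_Suc of_nat_Suc)
    from DERIV_add[OF DERIV_cmult[OF has_real_derivative_trunc_power[of ?q k z], of "a j"] R(2)[OF that]]
    show ?thesis unfolding F_def mj a[symmetric] by (simp only: mult.assoc)
  qed
  from diff have "\<forall>i\<in>{..<d - 1}. \<exists>p. (\<psi> has_real_derivative p) (at (z' i))"
    by (simp add: real_differentiable_def)
  then obtain p where p: "\<And>i. i < d - 1 \<Longrightarrow> (\<psi> has_real_derivative p i) (at (z' i))" by (auto simp: bchoice_iff)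
  have len: "length [1..<d - 1] = m" by (simp add: dm)
  have split: "[0..<d - 1] = 0 # [1..<d - 1]" using d by (simp add: upt_conv_Cons)
  have "(F m has_real_derivative D * p 0 * (\<Prod>j\<in>set [1..<d - 1]. p j)) (at ?q)"
  proof (rule has_iterated_partial_Cons_archimedean[OF g z _ _ _ D[unfolded split]])
    fix y E assume y: "\<And>j. j < d \<Longrightarrow> 0 < y j" "\<And>j. j \<in> set [1..<d - 1] \<Longrightarrow> y j = z' j"
      and E: "has_iterated_partial [1..<d - 1] (archimedean d \<psi>) (\<lambda>j\<in>{..<d}. \<psi> (y j)) E"
    have "E * (\<Prod>j\<in>set [1..<d - 1]. p j) = F (length [1..<d - 1]) (\<Sum>j<d. y j)"
    proof (rule has_iterated_partial_archimedean[where m = m and F = F and p = p and z = y, OF g F0 F _ _ _ _ y(1) _ E])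
      fix j assume "j \<in> set [1..<d - 1]"
      then show "(\<psi> has_real_derivative p j) (at (y j))" using p[of j] y(2)[of j] by simp
    qed (use dm in auto)
    then show "E * (\<Prod>j\<in>set [1..<d - 1]. p j) = F m (\<Sum>j<d. y j)" by (simp only: len)
  qed (use p d in auto)
  moreover have "F m = (\<lambda>z. c * fact (Suc m) * (- 1) ^ m * trunc_power ?q 1 z + R m z)"
    by (simp add: F_def a_def fun_eq_iff)
  ultimately show False
    using not_has_real_derivative_kink[OF q _ R(3), of "c * fact (Suc m)"] c by (auto simp del: fact_Suc)
qed

subsection \<open>Density\<close>

lemma alternating_contraction:
  assumes alt: "alternating {0..} k \<psi>" "2 \<le> k" and "0 \<le> a" "0 \<le> b" "0 \<le> r"
  shows "\<bar>\<psi> (a + r) - \<psi> (b + r)\<bar> \<le> \<bar>\<psi> a - \<psi> b\<bar>"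
proof -
  have anti: "\<psi> y \<le> \<psi> x" if "0 \<le> x" "x \<le> y" for x y
    using alternating_imp_antimono_on[OF alt(1)] alt(2) that by (auto simp: monotone_on_def)
  have le: "\<bar>\<psi> (a + r) - \<psi> (b + r)\<bar> \<le> \<bar>\<psi> a - \<psi> b\<bar>" if "0 \<le> a" "a \<le> b" for a b
    using alt_diff_monotone_step[OF alt, of a "b - a" r] anti[of a b] anti[of "a + r" "b + r"] that \<open>0 \<le> r\<close>
    by simp
  show ?thesis using le[of a b] le[of b a] assms by (cases "a \<le> b") (auto simp: abs_minus_commute)
qed

text \<open>The summands are exchanged one at a time; each exchange is a common shift of two points,
  which does not increase the distance of their values.\<close>

lemma alternating_sum_contraction:
  fixes y z :: "nat \<Rightarrow> real"
  assumes alt: "alternating {0..} k \<psi>" "2 \<le> k"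
    and "\<And>i. 0 \<le> y i" "\<And>i. 0 \<le> z i"
  shows "\<bar>\<psi> (\<Sum>i<d. y i) - \<psi> (\<Sum>i<d. z i)\<bar> \<le> (\<Sum>i<d. \<bar>\<psi> (y i) - \<psi> (z i)\<bar>)"
proof (induction d)
  case (Suc d)
  let ?y = "\<Sum>i<d. y i" and ?z = "\<Sum>i<d. z i"
  have "\<bar>\<psi> (?y + y d) - \<psi> (?z + y d)\<bar> \<le> \<bar>\<psi> ?y - \<psi> ?z\<bar>"
    "\<bar>\<psi> (y d + ?z) - \<psi> (z d + ?z)\<bar> \<le> \<bar>\<psi> (y d) - \<psi> (z d)\<bar>"
    using assms by (intro alternating_contraction[OF alt] sum_nonneg; simp)+
  then show ?case using Suc by (simp add: add.commute)
qed simp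

text \<open>Let \<open>y\<close> and \<open>z\<close> be the parameters of \<open>u\<close> under
  \<open>\<psi>\<close> and \<open>\<eta>\<close>. As \<open>\<psi> (y i) = \<eta> (z i)\<close>,
  replacing \<open>y\<close> by \<open>z\<close> inside \<open>\<psi>\<close> costs at most
  \<open>\<delta>\<close> per coordinate; replacing \<open>\<psi>\<close> by \<open>\<eta>\<close>
  at the sum costs one more.\<close>

lemma archimedean_dist_le:
  assumes \<psi>: "generator \<psi>" "alternating {0..} k \<psi>" "2 \<le> k" and \<eta>: "generator \<eta>"
    and close: "\<And>z. 0 \<le> z \<Longrightarrow> \<bar>\<psi> z - \<eta> z\<bar> \<le> \<delta>" and u: "u \<in> cube d"
  shows "\<bar>archimedean d \<psi> u - archimedean d \<eta> u\<bar> \<le> (real d + 1) * \<delta>"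
proof (cases "\<exists>i<d. u i = 0")
  case True
  have "0 \<le> \<delta>" using close[of 0] by simp
  then show ?thesis using True archimedean_eq_0[OF \<psi>(1) u] archimedean_eq_0[OF \<eta> u] by auto
next
  case False
  then have pos: "0 < u i" if "i < d" for i
    using u that by (force simp: cube_def PiE_iff order_less_le)
  obtain y where y: "\<And>i. 0 \<le> y i" "\<And>i. i < d \<Longrightarrow> \<psi> (y i) = u i" "u = (\<lambda>i\<in>{..<d}. \<psi> (y i))"
    using cube_generatorE[OF \<psi>(1) u pos] by blast
  obtain z where z: "\<And>i. 0 \<le> z i" "\<And>i. i < d \<Longrightarrow> \<eta> (z i) = u i" "u = (\<lambda>i\<in>{..<d}. \<eta> (z i))"
    using cube_generatorE[OF \<eta> u pos] by blast
  have "archimedean d \<psi> u = \<psi> (\<Sum>i<d. y i)"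
    using archimedean_generator[OF \<psi>(1), of d y] y(1) by (subst y(3)) simp
  moreover have "archimedean d \<eta> u = \<eta> (\<Sum>i<d. z i)"
    using archimedean_generator[OF \<eta>, of d z] z(1) by (subst z(3)) simp
  moreover have "\<bar>\<psi> (\<Sum>i<d. z i) - \<eta> (\<Sum>i<d. z i)\<bar> \<le> \<delta>"
    using z(1) by (intro close sum_nonneg)
  moreover have "\<bar>\<psi> (\<Sum>i<d. y i) - \<psi> (\<Sum>i<d. z i)\<bar> \<le> (\<Sum>i<d. \<bar>\<psi> (y i) - \<psi> (z i)\<bar>)"
    using y(1) z(1) by (intro alternating_sum_contraction[OF \<psi>(2,3)])
  moreover have "(\<Sum>i<d. \<bar>\<psi> (y i) - \<psi> (z i)\<bar>) \<le> (\<Sum>i<d. \<delta>)"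
  proof (rule sum_mono)
    fix i assume "i \<in> {..<d}"
    then show "\<bar>\<psi> (y i) - \<psi> (z i)\<bar> \<le> \<delta>"
      using close[OF z(1)[of i]] y(2)[of i] z(2)[of i] by (simp add: abs_minus_commute)
  qed
  ultimately show ?thesis by (simp add: algebra_simps)
qed

lemma uniform_dist_archimedean_le:
  assumes "generator \<psi>" "alternating {0..} k \<psi>" "2 \<le> k" "generator \<eta>"
    and "\<And>z. 0 \<le> z \<Longrightarrow> \<bar>\<psi> z - \<eta> z\<bar> \<le> \<delta>"
  shows "uniform_dist d (archimedean d \<psi>) (archimedean d \<eta>) \<le> (real d + 1) * \<delta>"
  unfolding uniform_dist_def
proof (rule cSUP_least)
  show "cube d \<noteq> {}" by (simp add: cube_def PiE_eq_empty_iff)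
qed (rule archimedean_dist_le[OF assms])

text \<open>Since \<open>\<delta> > 0\<close>, the mixture inherits strict decrease on the whole
  half-line from \<open>\<eta>\<close>, which settles the last clause of \<open>generator\<close>
  wherever the zeros of \<open>\<psi>\<close> lie.\<close>

lemma generator_mixture:
  assumes g: "generator \<psi>" and \<delta>: "0 < \<delta>" "\<delta> \<le> 1"
    and \<eta>: "continuous_on {0..} \<eta>" "\<eta> 0 = 1" "(\<eta> \<longlongrightarrow> 0) at_top" "\<And>z. 0 \<le> z \<Longrightarrow> 0 \<le> \<eta> z"
    and strict: "\<And>x y. 0 \<le> x \<Longrightarrow> x < y \<Longrightarrow> \<eta> y < \<eta> x"
  shows "generator (\<lambda>z. (1 - \<delta>) * \<psi> z + \<delta> * \<eta> z)" (is "generator ?\<chi>")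
proof -
  have lt: "?\<chi> y < ?\<chi> x" if "0 \<le> x" "x < y" for x y
    using strict[OF that] generator_antimono[OF g, of x y] that \<delta>
    by (intro add_le_less_mono mult_left_mono mult_strict_left_mono) auto
  then have le: "?\<chi> y \<le> ?\<chi> x" if "0 \<le> x" "x \<le> y" for x y
    using that by (cases "x = y") (auto intro: less_imp_le)
  have 0: "?\<chi> 0 = 1" using \<eta>(2) generator_0[OF g] by simp
  have "0 \<le> ?\<chi> z" if "0 \<le> z" for z
    using generator_range[OF g that] \<eta>(4)[OF that] \<delta> by simp
  moreover have "?\<chi> z \<le> 1" if "0 \<le> z" for z using le[of 0 z] 0 that by simp
  ultimately have "?\<chi> ` {0..} \<subseteq> {0..1}" by auto
  moreover have "continuous_on {0..} ?\<chi>"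
    by (intro continuous_intros generator_continuous[OF g] \<eta>(1))
  moreover have "antimono_on {0..} ?\<chi>" by (rule monotone_onI) (use le in auto)
  moreover have "(?\<chi> \<longlongrightarrow> (1 - \<delta>) * 0 + \<delta> * 0) at_top"
    by (intro tendsto_intros generator_tendsto[OF g] \<eta>(3))
  moreover have "strict_antimono_on {x. 0 \<le> x \<and> ennreal x < Inf (ennreal ` {z. 0 \<le> z \<and> ?\<chi> z = 0})} ?\<chi>"
    by (rule monotone_onI) (use lt in auto)
  ultimately show ?thesis unfolding generator_def using 0 by simp
qed

lemma emeasure_lborel_n_co_countable:
  assumes N: "countable N"
  shows "(\<Pi>\<^sub>E i\<in>{..<n}. {0<..<1} - N) \<in> sets (lborel_n n)"
    and "emeasure (lborel_n n) (\<Pi>\<^sub>E i\<in>{..<n}. {0<..<1} - N) = 1"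
proof -
  interpret product_sigma_finite "\<lambda>_::nat. lborel :: real measure" ..
  have null: "N \<in> null_sets lborel" by (rule countable_imp_null_set_lborel[OF N])
  then have meas: "{0<..<1} - N \<in> sets (lborel :: real measure)" by auto
  show "(\<Pi>\<^sub>E i\<in>{..<n}. {0<..<1} - N) \<in> sets (lborel_n n)"
    unfolding lborel_n_def by (intro sets_PiM_I_finite meas) auto
  have "emeasure lborel ({0<..<1} - N) = 1"
    using emeasure_Diff_null_set[OF null, of "{0<..<1}"] by simp
  then show "emeasure (lborel_n n) (\<Pi>\<^sub>E i\<in>{..<n}. {0<..<1} - N) = 1"
    unfolding lborel_n_def using meas by (subst emeasure_PiM) auto
qed

lemma archimedean_in_archimedean_copulas_Q:
  assumes g: "generator \<psi>" and d: "2 \<le> d" and alt: "alternating {0..} d \<psi>"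
    and pos: "\<And>z. 0 \<le> z \<Longrightarrow> 0 < \<psi> z"
    and kink: "\<And>r. r \<in> \<rat> \<Longrightarrow> 0 < r \<Longrightarrow> \<exists>c \<rho>. 0 < c \<and> (\<forall>z>0. \<psi> z = c * trunc_power r (d - 1) z + \<rho> z) \<and>
      continuous_on {0<..} \<rho> \<and> alternating {0<..} d \<rho>"
  shows "archimedean d \<psi> \<in> archimedean_copulas_Q d"
proof -
  let ?C = "archimedean d \<psi>"
  have C: "?C \<in> archimedean_copulas d"
    unfolding archimedean_copulas_def using g alternating_imp_copula[OF g alt] d by auto
  define N where "N = {z \<in> {0<..}. \<not> \<psi> differentiable at z}"
  have "convex_on {0<..} \<psi>"
  proof (rule alternating_imp_convex_on[OF _ _ d])
    show "continuous_on {0<..} \<psi>" by (rule continuous_on_subset[OF generator_continuous[OF g]]) auto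
    show "alternating {0<..} d \<psi>" by (rule alternating_mono[OF alt order_refl]) auto
  qed
  then have N: "countable (\<psi> ` N)"
    unfolding N_def by (intro countable_image convex_on_countable_nondifferentiable)
  \<comment> \<open>The points all of whose coordinates have a preimage where \<open>\<psi>\<close>
    is differentiable.\<close>
  define \<Lambda> where "\<Lambda> = (\<Pi>\<^sub>E i\<in>{..<d - 1}. {0<..<1} - \<psi> ` N)"
  have strict: "\<psi> y < \<psi> x" if "0 \<le> x" "x < y" for x y
    using generator_strict_antimono[OF g that pos] that by simp
  have inverse: "\<exists>z>0. \<psi> z = y" if "y \<in> {0<..<1}" for y
    using generator_surj[OF g, of y] generator_0[OF g] that
    by (metis greaterThanLessThan_iff less_eq_real_def less_irrefl)
  have dense: "{0<..<1} \<subseteq> closure {y \<in> {0<..<1}.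
      \<not> (\<exists>D. has_iterated_partial [0..<d - 1] ?C (x(d - 1 := y)) D)}" (is "_ \<subseteq> closure ?S")
    if x: "x \<in> \<Lambda>" for x
  proof
    fix y0 :: real assume "y0 \<in> {0<..<1}"
    then obtain z0 where z0: "z0 > 0" "\<psi> z0 = y0" using inverse by blast
    have "\<exists>z>0. i < d - 1 \<longrightarrow> \<psi> z = x i \<and> \<psi> differentiable at z" for i
    proof (cases "i < d - 1")
      case True
      then have xi: "x i \<in> {0<..<1}" "x i \<notin> \<psi> ` N" using x by (auto simp: \<Lambda>_def PiE_iff)
      then obtain z where z: "z > 0" "\<psi> z = x i" using inverse by blast
      then have "z \<notin> N" using xi(2) by (metis imageI)
      then show ?thesis using z by (auto simp: N_def)
    qed (auto intro: exI[of _ 1])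
    then obtain z where z: "\<And>i. 0 < z i" "\<And>i. i < d - 1 \<Longrightarrow> \<psi> (z i) = x i"
      "\<And>i. i < d - 1 \<Longrightarrow> \<psi> differentiable at (z i)" by metis
    define s where "s = (\<Sum>i<d - 1. z i)"
    have s: "0 \<le> s" unfolding s_def using z(1) by (intro sum_nonneg) (simp add: less_imp_le)
    show "y0 \<in> closure ?S"
      unfolding closure_approachable
    proof (intro allI impI)
      fix e :: real assume "e > 0"
      have "isCont \<psi> z0"
        using generator_continuous[OF g] z0(1)
        by (intro continuous_on_interior[of "{0..}"]) auto
      then obtain e' where e': "e' > 0" "\<And>w. dist w z0 < e' \<Longrightarrow> dist (\<psi> w) (\<psi> z0) < e"
        using \<open>e > 0\<close> unfolding continuous_at_eps_delta by blast
      \<comment> \<open>A rational slightly above \<open>s + z0\<close> makes the last parameter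
        \<open>w = r - s\<close> positive and close to \<open>z0\<close>, while all \<open>d\<close>
        parameters add up to the kink \<open>r\<close>.\<close>
      obtain r where r: "r \<in> \<rat>" "s + z0 < r" "r < s + z0 + e'"
        using Rats_dense_in_real[of "s + z0" "s + z0 + e'"] e'(1) by auto
      define w where "w = r - s"
      have w: "z0 < w" "dist w z0 < e'" using r by (auto simp: w_def dist_real_def)
      define v where "v = z(d - 1 := w)"
      have v: "0 < v i" for i using z(1) w(1) z0(1) by (simp add: v_def)
      have r0: "0 < r" using s z0(1) r(2) by simp
      have "(\<Sum>i<d. v i) = (\<Sum>i<Suc (d - 1). v i)" using d by simp
      also have "\<dots> = s + w" by (simp add: v_def s_def)
      finally have sum: "(\<Sum>i<d. v i) = r" by (simp add: w_def)
      obtain c \<rho> where c: "0 < c" "\<And>z. 0 < z \<Longrightarrow> \<psi> z = c * trunc_power (\<Sum>i<d. v i) (d - 1) z + \<rho> z"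
        "continuous_on {0<..} \<rho>" "alternating {0<..} d \<rho>"
        using kink[OF r(1) r0] unfolding sum by blast
      have "x(d - 1 := \<psi> w) = (\<lambda>i\<in>{..<d}. \<psi> (v i))"
      proof
        fix i
        show "(x(d - 1 := \<psi> w)) i = (\<lambda>i\<in>{..<d}. \<psi> (v i)) i"
          using x z(2)[of i] d by (cases "i < d - 1") (auto simp: v_def \<Lambda>_def PiE_iff extensional_def)
      qed
      moreover have "\<not> has_iterated_partial [0..<d - 1] ?C (\<lambda>i\<in>{..<d}. \<psi> (v i)) D" for D
        using v z(3) by (intro not_has_iterated_partial_archimedean[OF g d c]) (auto simp: v_def)
      moreover have "\<psi> w \<in> {0<..<1}"
        using pos[of w] strict[of 0 w] generator_0[OF g] w(1) z0(1) by simp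
      ultimately have "\<psi> w \<in> ?S" by simp
      then show "\<exists>y\<in>?S. dist y y0 < e" using e'(2)[OF w(2)] z0(2) by blast
    qed
  qed
  have "\<Lambda> \<subseteq> cube (d - 1)" unfolding \<Lambda>_def cube_def by (intro PiE_mono) auto
  then show ?thesis
    unfolding archimedean_copulas_Q_def
    using C dense emeasure_lborel_n_co_countable[OF N, of "d - 1", folded \<Lambda>_def] by blast
qed

theorem corollary5p3:
  fixes d :: nat
  assumes "d \<ge> 2"
  shows "\<forall>C\<in>archimedean_copulas d. \<forall>\<epsilon>>0. \<exists>C'\<in>archimedean_copulas_Q d. uniform_dist d C C' < \<epsilon>"
proof (intro ballI allI impI)
  fix C and \<epsilon> :: real assume "C \<in> archimedean_copulas d" and \<epsilon>: "0 < \<epsilon>"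
  then obtain \<psi> where g: "generator \<psi>" and C: "copula d C" "C = archimedean d \<psi>"
    by (auto simp: archimedean_copulas_def)
  define m where "m = d - 1"
  have m: "0 < m" "d = Suc m" using assms by (simp_all add: m_def)
  have alt: "alternating {0..} d \<psi>"
    using copula_imp_alternating[OF g] C assms by simp
  define Q where "Q = {r :: real. r \<in> \<rat> \<and> 0 < r}"
  have "countable Q" "Q \<noteq> {}"
    unfolding Q_def by (auto intro: countable_subset[OF _ countable_rat] exI[of _ 1])
  then obtain q :: "nat \<Rightarrow> real" where q: "range q = Q"
    by (metis range_from_nat_into)
  have q_pos: "0 < q n" for n using q by (auto simp: Q_def)
  \<comment> \<open>Positive weights put a kink at every positive rational, and total mass 1 gives
    \<open>\<eta> 0 = 1\<close>.\<close>
  define w :: "nat \<Rightarrow> real" where "w n = (1 / 2) ^ Suc n" for n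
  have w: "w sums 1" "0 < w n" for n
    unfolding w_def using power_half_series by auto
  have w': "0 \<le> w n" "summable w" for n
    using w by (auto simp: sums_iff intro: less_imp_le)
  note mix = w' q_pos m(1)
  define \<eta> where "\<eta> = mix w q m"
  have \<eta>_alt: "alternating {0..} d \<eta>" unfolding \<eta>_def m(2) using mix by (rule alternating_mix)
  have \<eta>_nonneg: "0 \<le> \<eta> z" if "0 \<le> z" for z
    using alternatingD[OF \<eta>_alt, of "[]" z] that by simp
  have \<eta>_strict: "\<eta> y < \<eta> x" if "0 \<le> x" "x < y" for x y
  proof -
    \<comment> \<open>A rational beyond \<open>x\<close> provides a summand that is strictly
      decreasing at \<open>x\<close>.\<close>
    obtain r where "r \<in> \<rat>" "x < r" using Rats_dense_in_real[of x "x + 1"] by auto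
    then have "r \<in> range q" using q that by (simp add: Q_def)
    then obtain n where "x < q n" using \<open>x < r\<close> by auto
    then show ?thesis unfolding \<eta>_def by (rule mix_strict_antimono[OF mix that _ w(2)])
  qed
  have \<eta>: "continuous_on {0..} \<eta>" "\<eta> 0 = 1" "(\<eta> \<longlongrightarrow> 0) at_top"
    unfolding \<eta>_def using continuous_on_mix[OF mix] mix_0[OF mix] mix_tendsto_0[OF mix] w(1)
    by (simp_all add: sums_iff)
  \<comment> \<open>The minimum keeps \<open>1 - \<delta>\<close> nonnegative; \<open>d + 2\<close>
    in place of \<open>d + 1\<close> makes the final estimate strict.\<close>
  define \<delta> where "\<delta> = min 1 (\<epsilon> / (real d + 2))"
  have \<delta>: "0 < \<delta>" "\<delta> \<le> 1" using \<epsilon> by (auto simp: \<delta>_def)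
  define \<phi> where "\<phi> z = (1 - \<delta>) * \<psi> z + \<delta> * \<eta> z" for z
  have \<phi>: "generator \<phi>"
    unfolding \<phi>_def by (rule generator_mixture[OF g \<delta> \<eta> \<eta>_nonneg \<eta>_strict])
  have "archimedean d \<phi> \<in> archimedean_copulas_Q d"
  proof (rule archimedean_in_archimedean_copulas_Q[OF \<phi> assms])
    show "alternating {0..} d \<phi>"
      unfolding \<phi>_def using \<delta> by (intro alternating_add alternating_cmult alt \<eta>_alt) auto
    show "0 < \<phi> z" if "0 \<le> z" for z
      using \<eta>_strict[OF that, of "z + 1"] \<eta>_nonneg[of "z + 1"] generator_range[OF g that] \<delta> that
      unfolding \<phi>_def by (intro add_nonneg_pos mult_nonneg_nonneg mult_pos_pos) auto
    fix r :: real assume r: "r \<in> \<rat>" "0 < r"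
    then have "r \<in> range q" using q by (simp add: Q_def)
    then obtain n where n: "q n = r" by auto
    define v where "v = w(n := 0)"
    have v: "0 \<le> v k" "summable v" for k
    proof -
      have "norm (v k) \<le> w k" for k using w'(1) by (simp add: v_def)
      then show "summable v" by (rule summable_comparison_test'[OF w'(2), where N = 0])
    qed (use w'(1) in \<open>simp add: v_def\<close>)
    note mix_v = v q_pos m(1)
    \<comment> \<open>The mixture with the summand at \<open>r\<close> deleted; it is still
      alternating of order \<open>d\<close>, as setting a weight to 0 keeps the weights nonnegative
      and summable.\<close>
    define \<rho> where "\<rho> z = (1 - \<delta>) * \<psi> z + \<delta> * mix v q m z" for z
    have "\<phi> z = \<delta> * (w n / q n ^ m) * trunc_power r (d - 1) z + \<rho> z" if "0 < z" for z
      using mix_split[where q = q and z = z and n = n, OF mix] that n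
      by (simp add: \<phi>_def \<rho>_def \<eta>_def v_def m(2) algebra_simps)
    moreover have "0 < \<delta> * (w n / q n ^ m)" using \<delta> w(2) q_pos by simp
    moreover have "continuous_on {0<..} \<rho>"
      unfolding \<rho>_def using generator_continuous[OF g] continuous_on_mix[where q = q, OF mix_v]
      by (intro continuous_intros) (auto intro: continuous_on_subset)
    moreover have "alternating {0..} d \<rho>"
      unfolding \<rho>_def using \<delta> alternating_mix[where q = q, OF mix_v]
      by (intro alternating_add alternating_cmult alt) (auto simp: m(2))
    then have "alternating {0<..} d \<rho>" by (rule alternating_mono) auto
    ultimately show "\<exists>c \<rho>. 0 < c \<and> (\<forall>z>0. \<phi> z = c * trunc_power r (d - 1) z + \<rho> z) \<and>
        continuous_on {0<..} \<rho> \<and> alternating {0<..} d \<rho>" by blast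
  qed
  moreover have "uniform_dist d C (archimedean d \<phi>) < \<epsilon>"
  proof -
    have "\<bar>\<psi> z - \<phi> z\<bar> \<le> \<delta>" if "0 \<le> z" for z
    proof -
      have "\<eta> z \<le> \<eta> 0" using \<eta>_strict[of 0 z] that by (cases "z = 0") auto
      then have "\<bar>\<psi> z - \<eta> z\<bar> \<le> 1"
        using generator_range[OF g that] \<eta>_nonneg[OF that] \<eta>(2) by auto
      moreover have "\<psi> z - \<phi> z = \<delta> * (\<psi> z - \<eta> z)" by (simp add: \<phi>_def algebra_simps)
      ultimately show ?thesis using \<delta>(1) by (simp add: abs_mult mult_left_le)
    qed
    then have "uniform_dist d C (archimedean d \<phi>) \<le> (real d + 1) * \<delta>"
      unfolding C(2) using uniform_dist_archimedean_le[OF g alt assms \<phi>] by blast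
    also have "\<dots> \<le> (real d + 1) * (\<epsilon> / (real d + 2))"
      by (intro mult_left_mono) (auto simp: \<delta>_def)
    also have "\<dots> < \<epsilon>" using \<epsilon> by (simp add: field_simps)
    finally show ?thesis .
  qed
  ultimately show "\<exists>C'\<in>archimedean_copulas_Q d. uniform_dist d C C' < \<epsilon>" by blast
qed

end
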